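(* Let $p\colon \mathbb{R}\times\mathbb{R}^d\times\mathbb{R}\times\mathbb{R}^d\to[0,\infty)$ satisfy, for all $s<u<t$ and $x,y\in\mathbb{R}^d$, the Chapman-Kolmogorov equation $\int_{\mathbb{R}^d}p(s,x,u,z)p(u,z,t,y)\,dz=p(s,x,t,y)$, and suppose that $\nabla_x p(s,x,t,y)$ exists and $\nabla_x p(s,x,t,y)=\int_{\mathbb{R}^d}\nabla_x p(s,x,u,z)\,p(u,z,t,y)\,dz$ with the integral absolutely convergent. Let $b\in\mathcal{N}(\eta,Q,p)$ with $0\le \eta<\frac12$. Then the perturbation series $\tilde p(s,x,t,y)=\sum_{n=0}^\infty p_n(s,x,t,y)$ converges absolutely, and there exists a constant $C>1$ such that for all $-\infty<s<t<\infty$ and $x,y\in\mathbb{R}^d$, $$\frac{p(s,x,t,y)}{C^{1+Q(s,t)}}\le \tilde p(s,x,t,y)\le p(s,x,t,y)\begin{cases}\left(\frac{1}{1-2\eta}\right)^{1+\frac{Q(s,t)}{\eta}}, & \text{if } 0<\eta<\frac12,\\[4pt] e^{Q(s,t)}, & \text{if } \eta=0,\end{cases}$$ and the Chapman-Kolmogorov equation holds for $\tilde p$: for all $s<u<t$ and $x,y\in\mathbb{R}^d$, $$\tilde p(s,x,t,y)=\int_{\mathbb{R}^d}\tilde p(s,x,u,z)\,\tilde p(u,z,t,y)\,dz .$$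
   Context: Here $d\ge 1$ is an integer and $b\colon\mathbb{R}\times\mathbb{R}^d\to\mathbb{R}^d$. The functions $p$ and $b$ are Borel measurable. The functions $p_n$ are defined for $s<t$, $x,y\in\mathbb{R}^d$ by $p_0=p$ and, for $n\ge1$, $$p_n(s,x,t,y)=\int_s^t\int_{\mathbb{R}^d}p_{n-1}(s,x,u,z)\,b(u,z)\cdot\nabla_z p(u,z,t,y)\,dz\,du .$$ Definition of $\mathcal{N}(\eta,Q,p)$: let $\eta\ge0$ and let $Q\colon\mathbb{R}\times\mathbb{R}\to[0,\infty)$ satisfy $Q(r,u)+Q(u,v)\le Q(r,v)$ for all $r<u<v$. We say $b\in\mathcal{N}(\eta,Q,p)$ if for all $-\infty<s<t<\infty$ and $x,y\in\mathbb{R}^d$, $$\int_s^t\int_{\mathbb{R}^d}p(s,x,u,z)\,|b(u,z)|\,|\nabla_z p(u,z,t,y)|\,dz\,du\le[\eta+Q(s,t)]\,p(s,x,t,y).$$ *)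

theory Defs
  imports "HOL-Analysis.Analysis"
begin

text \<open>
  The gradient is the vector of partial derivatives; its existence means that all
  partial derivatives exist. Total differentiability is not assumed. Where it holds, this
  is the gradient of the library (see \<open>GDERIV_imp_grad\<close> below).
\<close>

definition grad_exists :: "(real^'d \<Rightarrow> real) \<Rightarrow> real^'d \<Rightarrow> bool" where
  "grad_exists f x \<longleftrightarrow> (\<forall>i. (\<lambda>h::real. f (x + h *\<^sub>R axis i 1)) differentiable (at 0))"

definition grad :: "(real^'d \<Rightarrow> real) \<Rightarrow> real^'d \<Rightarrow> real^'d" where
  "grad f x = (\<chi> i. deriv (\<lambda>h::real. f (x + h *\<^sub>R axis i 1)) 0)"

lemma GDERIV_imp_grad:
  fixes f :: "real^'d \<Rightarrow> real"
  assumes "GDERIV f x :> D"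
  shows "grad_exists f x" and "grad f x = D"
proof -
  have *: "((\<lambda>h::real. f (x + h *\<^sub>R axis i 1)) has_real_derivative D $ i) (at 0)" for i
  proof -
    have f: "(f has_derivative (\<lambda>h. h \<bullet> D)) (at (x + 0 *\<^sub>R axis i 1))"
      using assms by (simp add: gderiv_def)
    have g: "((\<lambda>h::real. x + h *\<^sub>R axis i 1) has_derivative (\<lambda>h. h *\<^sub>R axis i 1)) (at 0)"
      by (auto intro!: derivative_eq_intros)
    have "((\<lambda>h::real. f (x + h *\<^sub>R axis i 1)) has_derivative (\<lambda>h. (h *\<^sub>R axis i 1) \<bullet> D)) (at 0)"
      using has_derivative_compose[OF g f] .
    moreover have "(\<lambda>h::real. (h *\<^sub>R axis i 1) \<bullet> D) = (*) (D $ i)"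
      by (auto simp: inner_axis' mult.commute)
    ultimately show ?thesis
      by (simp add: has_field_derivative_def)
  qed
  show "grad_exists f x"
    unfolding grad_exists_def using * by (auto simp: real_differentiable_def)
  show "grad f x = D"
    unfolding grad_def using * by (auto simp: vec_eq_iff intro!: DERIV_imp_deriv)
qed

text \<open>
  Open time intervals are used below because the kernels matter only for strictly ordered
  times; the endpoints are null sets.
\<close>

definition class_N ::
  "real \<Rightarrow> (real \<Rightarrow> real \<Rightarrow> real) \<Rightarrow> (real \<Rightarrow> real^'d \<Rightarrow> real \<Rightarrow> real^'d \<Rightarrow> real)
    \<Rightarrow> (real \<Rightarrow> real^'d \<Rightarrow> real^'d) set" where
  "class_N \<eta> Q p = {b. \<forall>s t x y. s < t \<longrightarrow>
     (\<integral>\<^sup>+u\<in>{s<..<t}. (\<integral>\<^sup>+z. ennreal (p s x u z * norm (b u z) * norm (grad (\<lambda>w. p u w t y) z)) \<partial>lborel) \<partial>lborel)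
       \<le> ennreal ((\<eta> + Q s t) * p s x t y)}"

primrec pert_term ::
  "(real \<Rightarrow> real^'d \<Rightarrow> real \<Rightarrow> real^'d \<Rightarrow> real) \<Rightarrow> (real \<Rightarrow> real^'d \<Rightarrow> real^'d) \<Rightarrow> nat
    \<Rightarrow> real \<Rightarrow> real^'d \<Rightarrow> real \<Rightarrow> real^'d \<Rightarrow> real" where
  "pert_term p b 0 = p"
| "pert_term p b (Suc n) = (\<lambda>s x t y.
     LBINT u:{s<..<t}. (LBINT z. pert_term p b n s x u z * (b u z \<bullet> grad (\<lambda>w. p u w t y) z)))"

definition pert_series ::
  "(real \<Rightarrow> real^'d \<Rightarrow> real \<Rightarrow> real^'d \<Rightarrow> real) \<Rightarrow> (real \<Rightarrow> real^'d \<Rightarrow> real^'d)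
    \<Rightarrow> real \<Rightarrow> real^'d \<Rightarrow> real \<Rightarrow> real^'d \<Rightarrow> real" where
  "pert_series p b s x t y = (\<Sum>n. pert_term p b n s x t y)"

end

theory Submission
  imports Defs "HOL-Real_Asymp.Real_Asymp"
begin

text \<open>
  Let \<open>q_n\<close> be the terms of the series with \<open>b \<cdot> \<nabla>p\<close> replaced by its absolute value. Splitting the
  time simplex at an intermediate time \<open>u\<close> gives \<open>p_n = \<Sum>m\<le>n. p_m p_(n-m)\<close> (composition
  at time \<open>u\<close>), and the same with \<open>\<le>\<close> for \<open>q_n\<close>, because the gradient of \<open>p\<close> passes under the
  Chapman-Kolmogorov integral. If \<open>Q \<le> \<theta>\<close> on all compact subintervals of \<open>(s, t)\<close>, monotone
  convergence gives \<open>q_1 \<le> (\<eta> + \<theta>) p\<close>, hence \<open>q_n \<le> (\<eta> + \<theta>)^n p\<close>, and geometric series bound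
  the perturbed kernel from both sides. An arbitrary interval is cut into at most
  \<open>1 + Q(s,t) / \<theta>\<close> such pieces, whose bounds multiply. The upper bound uses \<open>\<theta> = \<eta>\<close>, or
  \<open>\<theta> \<rightarrow> 0\<close> if \<open>\<eta> = 0\<close>; the lower bound uses \<open>\<eta> + \<theta> < 1/2\<close>.

  Points of space-time are pairs, and kernels are extended by \<open>0\<close> to pairs that are not
  strictly ordered in time, so that all time integrals run over the whole line.
\<close>

section \<open>Time slices, triangular sums and truncation in time\<close>

lemma fst_borel_measurable: "fst \<in> borel_measurable (borel :: (real \<times> 'a::euclidean_space) measure)"
  by (intro borel_measurable_continuous_onI continuous_intros)

text \<open>The slice is a product with a null time factor. Hence a space-time integral can be cut
  at time \<open>u\<close> into the parts strictly before and strictly after.\<close>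

lemma AE_lborel_fst_neq:
  "AE e in (lborel :: (real \<times> 'a::euclidean_space) measure). fst e \<noteq> u"
proof (rule AE_I)
  show "{e \<in> space lborel. \<not> fst e \<noteq> u} \<subseteq> {u} \<times> (UNIV :: 'a set)" by auto
  have "emeasure (lborel \<Otimes>\<^sub>M lborel) ({u} \<times> (UNIV :: 'a set)) = 0"
    by (subst lborel.emeasure_pair_measure_Times) auto
  then show "emeasure lborel ({u} \<times> (UNIV :: 'a set)) = 0"
    by (simp add: lborel_prod)
  have "{u} \<times> (UNIV :: 'a set) \<in> sets borel"
    by (intro borel_closed closed_Times) auto
  then show "{u} \<times> (UNIV :: 'a set) \<in> sets lborel" by simp
qed

text \<open>The index triangle \<open>i + j < N\<close> lies in the square \<open>i, j < N\<close>,
  and the extra summands are nonnegative. The type class covers both \<open>ennreal\<close> and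
  \<open>real\<close>.\<close>

lemma sum_triangle_le:
  fixes f g :: "nat \<Rightarrow> 'a::{ordered_semiring_0,ordered_comm_monoid_add}"
  assumes "\<And>i. 0 \<le> f i" "\<And>i. 0 \<le> g i"
  shows "(\<Sum>n<N. \<Sum>m\<le>n. f m * g (n - m)) \<le> (\<Sum>i<N. f i) * (\<Sum>j<N. g j)"
proof -
  have "(\<Sum>n<N. \<Sum>m\<le>n. f m * g (n - m)) = (\<Sum>(i, j)\<in>{(i, j). i + j < N}. f i * g j)"
    by (rule sum.triangle_reindex[symmetric])
  also have "\<dots> \<le> (\<Sum>(i, j)\<in>{..<N} \<times> {..<N}. f i * g j)"
    using assms by (intro sum_mono2) (auto intro: mult_nonneg_nonneg)
  also have "\<dots> = (\<Sum>i<N. f i) * (\<Sum>j<N. g j)"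
    by (simp add: sum_product sum.cartesian_product)
  finally show ?thesis .
qed

text \<open>Monotone convergence along times increasing to \<open>t\<close>; by \<open>supp\<close>
  the truncations exhaust the whole integral.\<close>

lemma nn_integral_le_if_truncated_right:
  fixes F :: "real \<times> 'a::euclidean_space \<Rightarrow> ennreal"
  assumes [measurable]: "F \<in> borel_measurable borel" and "s < t"
    and supp: "\<And>e. \<not> fst e < t \<Longrightarrow> F e = 0"
    and bound: "\<And>v. s < v \<Longrightarrow> v < t \<Longrightarrow> (\<integral>\<^sup>+e. F e * indicator {e. fst e < v} e \<partial>lborel) \<le> B"
  shows "(\<integral>\<^sup>+e. F e \<partial>lborel) \<le> B"
proof -
  note fst_borel_measurable [measurable]
  \<comment> \<open>The shift by 2 keeps already \<open>v 0\<close> strictly above \<open>s\<close>;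
    a shift by 1 would give \<open>v 0 = s\<close>.\<close>
  define v where "v i = t - (t - s) / real (i + 2)" for i
  have v: "s < v i" "v i < t" for i
    using \<open>s < t\<close> divide_strict_left_mono[of 1 "real (i + 2)" "t - s"] by (auto simp: v_def)
  have v_mono: "v i \<le> v j" if "i \<le> j" for i j
    using that \<open>s < t\<close> by (auto simp: v_def intro!: divide_left_mono)
  have v_lim: "v \<longlonglongrightarrow> t"
  proof -
    have "(\<lambda>i. (t - s) / real (i + 2)) \<longlonglongrightarrow> 0"
      by (intro LIMSEQ_ignore_initial_segment[of "\<lambda>i. (t - s) / real i"] lim_const_over_n)
    from tendsto_diff[OF tendsto_const[of t] this] show ?thesis
      by (simp add: v_def[abs_def])
  qed
  have "(\<lambda>i. \<integral>\<^sup>+e. F e * indicator {e. fst e < v i} e \<partial>lborel) \<longlonglongrightarrow> (\<integral>\<^sup>+e. F e \<partial>lborel)"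
  proof (rule nn_integral_LIMSEQ)
    show "incseq (\<lambda>i e. F e * indicator {e. fst e < v i} e)"
      using v_mono by (fastforce simp: incseq_def le_fun_def split: split_indicator)
    show "(\<lambda>e. F e * indicator {e. fst e < v i} e) \<in> borel_measurable lborel" for i
      by measurable
    show "(\<lambda>i. F e * indicator {e. fst e < v i} e) \<longlonglongrightarrow> F e" for e
    proof (cases "fst e < t")
      case True
      then have "eventually (\<lambda>i. fst e < v i) sequentially"
        using v_lim by (simp add: order_tendsto_iff)
      then show ?thesis
        by (intro tendsto_eventually) (auto elim!: eventually_mono)
    qed (simp add: supp)
  qed
  then show ?thesis
    by (rule LIMSEQ_le_const2) (use v bound in auto)
qed

text \<open>Time-reversed counterpart: the truncation times decrease to \<open>s\<close>.\<close>

lemma nn_integral_le_if_truncated_left: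
  fixes F :: "real \<times> 'a::euclidean_space \<Rightarrow> ennreal"
  assumes [measurable]: "F \<in> borel_measurable borel" and "s < t"
    and supp: "\<And>e. \<not> s < fst e \<Longrightarrow> F e = 0"
    and bound: "\<And>u. s < u \<Longrightarrow> u < t \<Longrightarrow> (\<integral>\<^sup>+e. F e * indicator {e. u < fst e} e \<partial>lborel) \<le> B"
  shows "(\<integral>\<^sup>+e. F e \<partial>lborel) \<le> B"
proof -
  note fst_borel_measurable [measurable]
  define v where "v i = s + (t - s) / real (i + 2)" for i
  have v: "s < v i" "v i < t" for i
    using \<open>s < t\<close> divide_strict_left_mono[of 1 "real (i + 2)" "t - s"] by (auto simp: v_def)
  have v_mono: "v j \<le> v i" if "i \<le> j" for i j
    using that \<open>s < t\<close> by (auto simp: v_def intro!: divide_left_mono)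
  have v_lim: "v \<longlonglongrightarrow> s"
  proof -
    have "(\<lambda>i. (t - s) / real (i + 2)) \<longlonglongrightarrow> 0"
      by (intro LIMSEQ_ignore_initial_segment[of "\<lambda>i. (t - s) / real i"] lim_const_over_n)
    from tendsto_add[OF tendsto_const[of s] this] show ?thesis
      by (simp add: v_def[abs_def])
  qed
  have "(\<lambda>i. \<integral>\<^sup>+e. F e * indicator {e. v i < fst e} e \<partial>lborel) \<longlonglongrightarrow> (\<integral>\<^sup>+e. F e \<partial>lborel)"
  proof (rule nn_integral_LIMSEQ)
    show "incseq (\<lambda>i e. F e * indicator {e. v i < fst e} e)"
      using v_mono by (fastforce simp: incseq_def le_fun_def split: split_indicator)
    show "(\<lambda>e. F e * indicator {e. v i < fst e} e) \<in> borel_measurable lborel" for i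
      by measurable
    show "(\<lambda>i. F e * indicator {e. v i < fst e} e) \<longlonglongrightarrow> F e" for e
    proof (cases "s < fst e")
      case True
      then have "eventually (\<lambda>i. v i < fst e) sequentially"
        using v_lim by (simp add: order_tendsto_iff)
      then show ?thesis
        by (intro tendsto_eventually) (auto elim!: eventually_mono)
    qed (simp add: supp)
  qed
  then show ?thesis
    by (rule LIMSEQ_le_const2) (use v bound in auto)
qed

section \<open>Superadditive functions and the cutting of intervals\<close>

locale superadditive =
  fixes Q :: "real \<Rightarrow> real \<Rightarrow> real"
  assumes Q_nonneg: "0 \<le> Q r v"
    and Q_superadditive: "r < u \<Longrightarrow> u < v \<Longrightarrow> Q r u + Q u v \<le> Q r v"
begin

definition inner_bound :: "real \<Rightarrow> real \<Rightarrow> real \<Rightarrow> bool" where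
  "inner_bound \<theta> s t \<longleftrightarrow> (\<forall>u v. s < u \<longrightarrow> u < v \<longrightarrow> v < t \<longrightarrow> Q u v \<le> \<theta>)"

text \<open>Superadditivity lets the outer pieces be split off, and their values are
  nonnegative.\<close>

lemma Q_mono: "r' \<le> r \<Longrightarrow> r < v \<Longrightarrow> v \<le> v' \<Longrightarrow> Q r v \<le> Q r' v'"
  using Q_superadditive[of r' r v] Q_superadditive[of r' v v'] Q_nonneg[of r' r] Q_nonneg[of v v']
  by (cases "r' = r"; cases "v = v'") auto

lemma inner_bound_self: "inner_bound (Q s t) s t"
  by (auto simp: inner_bound_def intro: Q_mono)

text \<open>
  Since \<open>Q\<close> may jump, an interval need not split into pieces on which \<open>Q\<close> itself is small, but
  cutting at the jumps makes \<open>Q\<close> small strictly inside each piece. The cut is the supremum of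
  the times up to which \<open>Q\<close> is bounded by \<open>\<theta>\<close> inside; past it, superadditivity leaves
  \<open>n * \<theta>\<close> of the budget \<open>(n + 1) * \<theta>\<close>.
\<close>

lemma inner_bound_induct:
  assumes base: "\<And>s t. s < t \<Longrightarrow> inner_bound \<theta> s t \<Longrightarrow> R 1 s t"
    and split: "\<And>n s u t. s < u \<Longrightarrow> u < t \<Longrightarrow> R 1 s u \<Longrightarrow> R n u t \<Longrightarrow> R (Suc n) s t"
    and mono: "\<And>n s t. s < t \<Longrightarrow> R n s t \<Longrightarrow> R (Suc n) s t"
    and "s < t" "n \<ge> 1" "inner_bound (real n * \<theta>) s t"
  shows "R n s t"
  using assms(5,4,6)
proof (induction n arbitrary: s t rule: nat_induct_at_least)
  case base
  then show ?case using assms(1) by simp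
next
  case (Suc n)
  let ?A = "{v. v \<le> t \<and> (s < v \<longrightarrow> inner_bound \<theta> s v)}"
  define c where "c = Sup ?A"
  have bdd: "bdd_above ?A" by (auto simp: bdd_above_def)
  have s_A: "s \<in> ?A" using \<open>s < t\<close> by auto
  have c_le: "c \<le> t" unfolding c_def using s_A by (intro cSup_least) auto
  have s_le: "s \<le> c" unfolding c_def using s_A bdd by (intro cSup_upper)
  have left: "inner_bound \<theta> s c"
    unfolding inner_bound_def
  proof safe
    fix u v assume uv: "s < u" "u < v" "v < c"
    then obtain v' where "v' \<in> ?A" "v < v'"
      unfolding c_def using less_cSup_iff[OF _ bdd, of v] s_A by blast
    with uv show "Q u v \<le> \<theta>" by (auto simp: inner_bound_def)
  qed
  have right: "inner_bound (real n * \<theta>) c t"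
    unfolding inner_bound_def
  proof safe
    fix u v assume uv: "c < u" "u < v" "v < t"
    then have "u \<notin> ?A" using cSup_upper[OF _ bdd, of u] unfolding c_def by force
    with uv obtain u' v' where u'v': "s < u'" "u' < v'" "v' < u" "\<theta> < Q u' v'"
      by (auto simp: inner_bound_def not_le)
    have "Q u' u + Q u v \<le> Q u' v" using u'v' uv by (intro Q_superadditive) auto
    moreover have "Q u' v' \<le> Q u' u" using u'v' by (intro Q_mono) auto
    moreover have "Q u' v \<le> real (Suc n) * \<theta>"
      using Suc.prems(2) u'v' uv unfolding inner_bound_def by (meson less_trans)
    ultimately show "Q u v \<le> real n * \<theta>" using u'v' by (simp add: algebra_simps)
  qed
  \<comment> \<open>If the cut falls on an endpoint, one of the two pieces is empty and
    \<open>mono\<close> makes up for the missing index.\<close>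
  consider "c = s" | "c = t" | "s < c" "c < t" using s_le c_le by fastforce
  then show ?case
  proof cases
    case 1
    with right Suc show ?thesis by (intro mono) auto
  next
    case 2
    have "R m s t" if "m \<ge> 1" for m
      using that by (induction m rule: nat_induct_at_least) (use 2 left \<open>s < t\<close> base mono in auto)
    then show ?thesis by simp
  next
    case 3
    with left right Suc show ?thesis by (intro split[of s c] assms(1)) auto
  qed
qed

text \<open>Rounding \<open>Q s t / \<theta>\<close> up to a positive integer costs at most 1. This
  is the origin of the exponents \<open>1 + Q s t / \<theta>\<close>.\<close>

lemma inner_bound_pieces:
  assumes "0 < \<theta>"
  obtains n where "n \<ge> 1" "real n \<le> 1 + Q s t / \<theta>" "inner_bound (real n * \<theta>) s t"
proof -
  define n where "n = max 1 (nat \<lceil>Q s t / \<theta>\<rceil>)"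
  have "Q s t / \<theta> \<le> real n"
    by (simp add: n_def) linarith
  then have "Q s t \<le> real n * \<theta>"
    using assms by (simp add: field_simps)
  then have "inner_bound (real n * \<theta>) s t"
    using inner_bound_self[of s t] by (auto simp: inner_bound_def intro: order_trans)
  moreover have "real n \<le> 1 + Q s t / \<theta>"
  proof -
    have "0 \<le> Q s t / \<theta>" using assms by (simp add: Q_nonneg)
    then show ?thesis by (simp add: n_def max_def) linarith
  qed
  moreover have "n \<ge> 1" by (simp add: n_def)
  ultimately show ?thesis by (intro that)
qed

end

section \<open>Space-time kernels, terms of the series and their majorants\<close>

text \<open>\<open>P\<close> stands for p and \<open>K\<close> for the product of b with the
  gradient of p in its first space variable. The gradient enters only through \<open>K\<close>: its
  exchange with the Chapman-Kolmogorov integral becomes \<open>K_P\<close>, and membership of b in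
  the class yields \<open>P_K_bound\<close>.\<close>

locale perturbed_kernel = superadditive Q for Q +
  fixes P K :: "real \<times> 'a::euclidean_space \<Rightarrow> real \<times> 'a \<Rightarrow> real"
    and \<eta> :: real
  assumes P_measurable: "case_prod P \<in> borel_measurable (borel \<Otimes>\<^sub>M borel)"
    and K_measurable: "case_prod K \<in> borel_measurable (borel \<Otimes>\<^sub>M borel)"
    and P_nonneg: "0 \<le> P a c"
    and P_support: "\<not> fst a < fst c \<Longrightarrow> P a c = 0"
    and K_support: "\<not> fst a < fst c \<Longrightarrow> K a c = 0"
    and P_P: "fst a < u \<Longrightarrow> u < fst c \<Longrightarrow>
      has_bochner_integral lborel (\<lambda>z. P a (u, z) * P (u, z) c) (P a c)"
    and K_P: "fst a < u \<Longrightarrow> u < fst c \<Longrightarrow>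
      has_bochner_integral lborel (\<lambda>z. K a (u, z) * P (u, z) c) (K a c)"
    and \<eta>_nonneg: "0 \<le> \<eta>"
    and P_K_bound: "fst a < fst c \<Longrightarrow>
      (\<integral>\<^sup>+e. ennreal (P a e) * ennreal \<bar>K e c\<bar> \<partial>lborel) \<le> ennreal ((\<eta> + Q (fst a) (fst c)) * P a c)"
begin

primrec kterm :: "nat \<Rightarrow> real \<times> 'a \<Rightarrow> real \<times> 'a \<Rightarrow> real" where
  "kterm 0 a c = P a c"
| "kterm (Suc n) a c = (LINT e|lborel. kterm n a e * K e c)"

primrec kmaj :: "nat \<Rightarrow> real \<times> 'a \<Rightarrow> real \<times> 'a \<Rightarrow> ennreal" where
  "kmaj 0 a c = ennreal (P a c)"
| "kmaj (Suc n) a c = (\<integral>\<^sup>+e. kmaj n a e * ennreal \<bar>K e c\<bar> \<partial>lborel)"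

lemma measurable_P [measurable (raw)]:
  "f \<in> borel_measurable M \<Longrightarrow> g \<in> borel_measurable M \<Longrightarrow> (\<lambda>x. P (f x) (g x)) \<in> borel_measurable M"
  using measurable_compose[OF measurable_Pair P_measurable, of f M g] by simp

lemma measurable_K [measurable (raw)]:
  "f \<in> borel_measurable M \<Longrightarrow> g \<in> borel_measurable M \<Longrightarrow> (\<lambda>x. K (f x) (g x)) \<in> borel_measurable M"
  using measurable_compose[OF measurable_Pair K_measurable, of f M g] by simp

lemma measurable_kmaj_pair: "case_prod (kmaj n) \<in> borel_measurable (borel \<Otimes>\<^sub>M borel)"
proof (induction n)
  case (Suc n)
  \<comment> \<open>The measure lives on triples \<open>((a, c), e)\<close>, where the integrand
    defining the next term has to be jointly measurable.\<close>
  have [measurable (raw)]: "f \<in> borel_measurable M \<Longrightarrow> g \<in> borel_measurable M \<Longrightarrow>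
      (\<lambda>x. kmaj n (f x) (g x)) \<in> borel_measurable M"
    for f g and M :: "(((real \<times> 'a) \<times> (real \<times> 'a)) \<times> (real \<times> 'a)) measure"
    using measurable_compose[OF measurable_Pair Suc.IH, of f M g] by simp
  show ?case
    unfolding kmaj.simps case_prod_beta by measurable
qed simp

lemma measurable_kmaj [measurable (raw)]:
  "f \<in> borel_measurable M \<Longrightarrow> g \<in> borel_measurable M \<Longrightarrow> (\<lambda>x. kmaj n (f x) (g x)) \<in> borel_measurable M"
  using measurable_compose[OF measurable_Pair measurable_kmaj_pair, of f M g] by simp

lemma measurable_kterm_pair: "case_prod (kterm n) \<in> borel_measurable (borel \<Otimes>\<^sub>M borel)"
proof (induction n)
  case (Suc n)
  have [measurable (raw)]: "f \<in> borel_measurable M \<Longrightarrow> g \<in> borel_measurable M \<Longrightarrow>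
      (\<lambda>x. kterm n (f x) (g x)) \<in> borel_measurable M"
    for f g and M :: "(((real \<times> 'a) \<times> (real \<times> 'a)) \<times> (real \<times> 'a)) measure"
    using measurable_compose[OF measurable_Pair Suc.IH, of f M g] by simp
  show ?case
    unfolding kterm.simps case_prod_beta by measurable
qed simp

lemma measurable_kterm [measurable (raw)]:
  "f \<in> borel_measurable M \<Longrightarrow> g \<in> borel_measurable M \<Longrightarrow> (\<lambda>x. kterm n (f x) (g x)) \<in> borel_measurable M"
  using measurable_compose[OF measurable_Pair measurable_kterm_pair, of f M g] by simp

lemma kmaj_support: "\<not> fst a < fst c \<Longrightarrow> kmaj n a c = 0"
proof (induction n arbitrary: c)
  case (Suc n)
  have "kmaj n a e * ennreal \<bar>K e c\<bar> = 0" for e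
    using Suc K_support[of e c] by (cases "fst a < fst e") auto
  then show ?case by (simp only: kmaj.simps nn_integral_const mult_zero_left)
qed (simp add: P_support)

lemma kterm_support: "\<not> fst a < fst c \<Longrightarrow> kterm n a c = 0"
proof (induction n arbitrary: c)
  case (Suc n)
  have "kterm n a e * K e c = 0" for e
    using Suc K_support[of e c] by (cases "fst a < fst e") auto
  then show ?case by (simp only: kterm.simps Bochner_Integration.integral_zero)
qed (simp add: P_support)

lemma kterm_le_kmaj: "ennreal \<bar>kterm n a c\<bar> \<le> kmaj n a c"
proof (induction n arbitrary: c)
  case (Suc n)
  show ?case
  \<comment> \<open>Integrability is not yet available. Where it fails, the integral has the default
    value 0 and the bound is trivial.\<close>
  proof (cases "integrable lborel (\<lambda>e. kterm n a e * K e c)")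
    case True
    from integral_norm_bound_ennreal[OF this]
    have "ennreal \<bar>kterm (Suc n) a c\<bar> \<le> (\<integral>\<^sup>+e. ennreal \<bar>kterm n a e\<bar> * ennreal \<bar>K e c\<bar> \<partial>lborel)"
      by (simp add: abs_mult ennreal_mult)
    also have "\<dots> \<le> kmaj (Suc n) a c"
      by (auto intro!: nn_integral_mono mult_right_mono Suc)
    finally show ?thesis .
  qed (simp add: not_integrable_integral_eq)
qed (simp add: P_nonneg)

section \<open>Composition of the majorants at an intermediate time\<close>

lemma nn_integral_P_P:
  assumes "fst a < u" "u < fst c"
  shows "(\<integral>\<^sup>+z. ennreal (P a (u, z)) * ennreal (P (u, z) c) \<partial>lborel) = ennreal (P a c)"
  using P_P[OF assms] by (subst ennreal_mult[symmetric])
    (auto simp: P_nonneg nn_integral_eq_integral has_bochner_integral_iff)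

text \<open>Bounds relative to \<open>P\<close> multiply under composition, since the two copies of
  \<open>P\<close> compose to \<open>P a c\<close>. This is how estimates on adjacent intervals are
  joined.\<close>

lemma nn_integral_comp_bound:
  assumes "fst a < u" "u < fst c"
    and "\<And>z. f z \<le> A * ennreal (P a (u, z))" "\<And>z. g z \<le> B * ennreal (P (u, z) c)"
  shows "(\<integral>\<^sup>+z. f z * g z \<partial>lborel) \<le> A * B * ennreal (P a c)"
proof -
  have "(\<integral>\<^sup>+z. f z * g z \<partial>lborel)
      \<le> (\<integral>\<^sup>+z. (A * B) * (ennreal (P a (u, z)) * ennreal (P (u, z) c)) \<partial>lborel)"
  proof (intro nn_integral_mono)
    fix z
    have "f z * g z \<le> (A * ennreal (P a (u, z))) * (B * ennreal (P (u, z) c))"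
      using assms by (intro mult_mono) auto
    then show "f z * g z \<le> (A * B) * (ennreal (P a (u, z)) * ennreal (P (u, z) c))"
      by (simp add: ac_simps)
  qed
  also have "\<dots> = A * B * ennreal (P a c)"
    by (simp add: nn_integral_cmult nn_integral_P_P assms)
  finally show ?thesis .
qed

lemma K_le_nn_integral:
  assumes "fst e < u" "u < fst c"
  shows "ennreal \<bar>K e c\<bar> \<le> (\<integral>\<^sup>+z. ennreal \<bar>K e (u, z)\<bar> * ennreal (P (u, z) c) \<partial>lborel)"
  using integral_norm_bound_ennreal[of lborel "\<lambda>z. K e (u, z) * P (u, z) c"] K_P[OF assms]
  by (simp add: has_bochner_integral_iff abs_mult ennreal_mult P_nonneg)

text \<open>When the last factor acts at a time before \<open>u\<close>, \<open>K_P\<close> expands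
  it through \<open>u\<close>. Tonelli then absorbs the integral over \<open>e\<close> into one more
  majorant step ending at time \<open>u\<close>.\<close>

lemma kmaj_before:
  assumes "fst a < u" "u < fst c"
  shows "(\<integral>\<^sup>+e. kmaj n a e * ennreal \<bar>K e c\<bar> * indicator {e. fst e < u} e \<partial>lborel)
    \<le> (\<integral>\<^sup>+z. kmaj (Suc n) a (u, z) * ennreal (P (u, z) c) \<partial>lborel)"
proof -
  have "(\<integral>\<^sup>+e. kmaj n a e * ennreal \<bar>K e c\<bar> * indicator {e. fst e < u} e \<partial>lborel)
      \<le> (\<integral>\<^sup>+e. kmaj n a e * (\<integral>\<^sup>+z. ennreal \<bar>K e (u, z)\<bar> * ennreal (P (u, z) c) \<partial>lborel) \<partial>lborel)"
    using K_le_nn_integral[OF _ assms(2)]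
    by (intro nn_integral_mono) (auto intro!: mult_left_mono split: split_indicator)
  also have "\<dots> = (\<integral>\<^sup>+e. (\<integral>\<^sup>+z. kmaj n a e * ennreal \<bar>K e (u, z)\<bar> * ennreal (P (u, z) c) \<partial>lborel) \<partial>lborel)"
    by (simp add: nn_integral_cmult[symmetric] mult.assoc)
  also have "\<dots> = (\<integral>\<^sup>+z. (\<integral>\<^sup>+e. kmaj n a e * ennreal \<bar>K e (u, z)\<bar> * ennreal (P (u, z) c) \<partial>lborel) \<partial>lborel)"
    by (rule lborel_pair.Fubini'[symmetric]) measurable
  also have "\<dots> = (\<integral>\<^sup>+z. kmaj (Suc n) a (u, z) * ennreal (P (u, z) c) \<partial>lborel)"
    by (simp add: nn_integral_multc)
  finally show ?thesis .
qed

text \<open>When the composition at \<open>u\<close> comes before the last factor, Tonelli lets this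
  factor extend the right-hand majorant by one step.\<close>

lemma kmaj_after:
  "(\<integral>\<^sup>+e. (\<integral>\<^sup>+z. kmaj m a (u, z) * kmaj k (u, z) e \<partial>lborel) * ennreal \<bar>K e c\<bar> \<partial>lborel)
    = (\<integral>\<^sup>+z. kmaj m a (u, z) * kmaj (Suc k) (u, z) c \<partial>lborel)"
proof -
  have "(\<integral>\<^sup>+e. (\<integral>\<^sup>+z. kmaj m a (u, z) * kmaj k (u, z) e \<partial>lborel) * ennreal \<bar>K e c\<bar> \<partial>lborel)
      = (\<integral>\<^sup>+e. (\<integral>\<^sup>+z. kmaj m a (u, z) * (kmaj k (u, z) e * ennreal \<bar>K e c\<bar>) \<partial>lborel) \<partial>lborel)"
    by (simp add: nn_integral_multc[symmetric] mult.assoc)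
  also have "\<dots> = (\<integral>\<^sup>+z. (\<integral>\<^sup>+e. kmaj m a (u, z) * (kmaj k (u, z) e * ennreal \<bar>K e c\<bar>) \<partial>lborel) \<partial>lborel)"
    by (rule lborel_pair.Fubini'[symmetric]) measurable
  also have "\<dots> = (\<integral>\<^sup>+z. kmaj m a (u, z) * kmaj (Suc k) (u, z) c \<partial>lborel)"
    by (simp add: nn_integral_cmult)
  finally show ?thesis .
qed

text \<open>Induction on \<open>n\<close>, splitting according to whether the last factor acts
  before or after \<open>u\<close>. The first case supplies the summand \<open>m = Suc n\<close>; in
  the second, the induction hypothesis ending at \<open>e\<close> supplies the others. The index
  \<open>m\<close> counts the factors acting before \<open>u\<close>.\<close>

lemma kmaj_sub_chapman_kolmogorov:
  assumes "fst a < u" "u < fst c"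
  shows "kmaj n a c \<le> (\<Sum>m\<le>n. \<integral>\<^sup>+z. kmaj m a (u, z) * kmaj (n - m) (u, z) c \<partial>lborel)"
  using assms(2)
proof (induction n arbitrary: c)
  case 0
  then show ?case by (simp add: nn_integral_P_P assms)
next
  case (Suc n)
  note fst_borel_measurable [measurable]
  let ?F = "\<lambda>e. kmaj n a e * ennreal \<bar>K e c\<bar>"
  let ?S = "\<lambda>e. \<Sum>m\<le>n. \<integral>\<^sup>+z. kmaj m a (u, z) * kmaj (n - m) (u, z) e \<partial>lborel"
  have "kmaj (Suc n) a c = (\<integral>\<^sup>+e. ?F e * indicator {e. fst e < u} e + ?F e * indicator {e. u < fst e} e \<partial>lborel)"
    unfolding kmaj.simps using AE_lborel_fst_neq[of u]
    by (intro nn_integral_cong_AE) (auto elim!: eventually_mono split: split_indicator)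
  also have "\<dots> = (\<integral>\<^sup>+e. ?F e * indicator {e. fst e < u} e \<partial>lborel) + (\<integral>\<^sup>+e. ?F e * indicator {e. u < fst e} e \<partial>lborel)"
    by (rule nn_integral_add) measurable
  also have "\<dots> \<le> (\<integral>\<^sup>+z. kmaj (Suc n) a (u, z) * ennreal (P (u, z) c) \<partial>lborel) + (\<integral>\<^sup>+e. ?S e * ennreal \<bar>K e c\<bar> \<partial>lborel)"
    using Suc.IH by (intro add_mono kmaj_before assms Suc.prems nn_integral_mono)
      (auto intro!: mult_right_mono split: split_indicator)
  also have "(\<integral>\<^sup>+e. ?S e * ennreal \<bar>K e c\<bar> \<partial>lborel)
      = (\<Sum>m\<le>n. \<integral>\<^sup>+z. kmaj m a (u, z) * kmaj (Suc (n - m)) (u, z) c \<partial>lborel)"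
    unfolding kmaj_after[symmetric] sum_distrib_right by (rule nn_integral_sum) measurable
  also have "\<dots> = (\<Sum>m\<le>n. \<integral>\<^sup>+z. kmaj m a (u, z) * kmaj (Suc n - m) (u, z) c \<partial>lborel)"
    by (intro sum.cong) (auto simp: Suc_diff_le)
  finally show ?case by (simp add: add.commute)
qed

section \<open>Powers and endpoint limits for the majorants\<close>

text \<open>Each further integration against \<open>K\<close> costs one factor \<kappa>. Only
  endpoints up to the time of \<open>c\<close> occur, because \<open>K e c'\<close> vanishes unless
  \<open>e\<close> precedes \<open>c'\<close>.\<close>

lemma kmaj_power_bound:
  assumes "\<And>e. fst e \<le> fst c \<Longrightarrow> kmaj 1 a e \<le> \<kappa> * ennreal (P a e)"
  shows "kmaj n a c \<le> \<kappa> ^ n * ennreal (P a c)"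
proof -
  have "kmaj n a c' \<le> \<kappa> ^ n * ennreal (P a c')" if "fst c' \<le> fst c" for c'
    using that
  proof (induction n arbitrary: c')
    case (Suc n)
    have "kmaj (Suc n) a c' \<le> (\<integral>\<^sup>+e. \<kappa> ^ n * (ennreal (P a e) * ennreal \<bar>K e c'\<bar>) \<partial>lborel)"
      unfolding kmaj.simps
    proof (intro nn_integral_mono)
      fix e
      show "kmaj n a e * ennreal \<bar>K e c'\<bar> \<le> \<kappa> ^ n * (ennreal (P a e) * ennreal \<bar>K e c'\<bar>)"
        using Suc.IH[of e] Suc.prems K_support[of e c']
        by (cases "fst e < fst c'") (auto simp: mult.assoc[symmetric] intro!: mult_right_mono)
    qed
    also have "\<dots> = \<kappa> ^ n * kmaj 1 a c'"
      by (simp add: nn_integral_cmult)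
    also have "\<dots> \<le> \<kappa> ^ n * (\<kappa> * ennreal (P a c'))"
      using assms[OF Suc.prems] by (intro mult_left_mono) auto
    finally show ?case by (simp add: ac_simps)
  qed simp
  then show ?thesis by simp
qed

lemma kmaj_one_bound: "kmaj 1 a c \<le> ennreal (\<eta> + Q (fst a) (fst c)) * ennreal (P a c)"
proof (cases "fst a < fst c")
  case True
  with P_K_bound[of a c] show ?thesis
    by (simp add: ennreal_mult' Q_nonneg \<eta>_nonneg P_nonneg)
qed (simp add: kmaj_support del: kmaj.simps)

text \<open>By monotonicity of \<open>Q\<close>, the factor for the full interval serves for all
  earlier endpoints. The bound is crude, but its finiteness supplies all the integrability for the
  signed terms.\<close>

lemma kmaj_bound: "kmaj n a c \<le> ennreal (\<eta> + Q (fst a) (fst c)) ^ n * ennreal (P a c)"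
proof (rule kmaj_power_bound)
  fix e :: "real \<times> 'a" assume le: "fst e \<le> fst c"
  show "kmaj 1 a e \<le> ennreal (\<eta> + Q (fst a) (fst c)) * ennreal (P a e)"
  proof (cases "fst a < fst e")
    case True
    note kmaj_one_bound
    also have "ennreal (\<eta> + Q (fst a) (fst e)) * ennreal (P a e) \<le> ennreal (\<eta> + Q (fst a) (fst c)) * ennreal (P a e)"
      using True le by (intro mult_right_mono ennreal_leI add_left_mono Q_mono) auto
    finally show ?thesis .
  qed (simp add: kmaj_support del: kmaj.simps)
qed

text \<open>Cutting the integral at \<open>v\<close> and composing through \<open>v\<close> uses the
  bound only at endpoints strictly before \<open>c\<close>. Letting \<open>v\<close> increase to the
  time of \<open>c\<close> hides a jump of \<open>Q\<close> there.\<close>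

lemma kmaj_one_limit_right:
  assumes "fst a < fst c"
    and bound: "\<And>v z. fst a < v \<Longrightarrow> v < fst c \<Longrightarrow> kmaj 1 a (v, z) \<le> \<kappa> * ennreal (P a (v, z))"
  shows "kmaj 1 a c \<le> \<kappa> * ennreal (P a c)"
proof -
  have "(\<integral>\<^sup>+e. kmaj 0 a e * ennreal \<bar>K e c\<bar> \<partial>lborel) \<le> \<kappa> * ennreal (P a c)"
  proof (rule nn_integral_le_if_truncated_right[OF _ \<open>fst a < fst c\<close>])
    fix v assume v: "fst a < v" "v < fst c"
    have "(\<integral>\<^sup>+z. kmaj (Suc 0) a (v, z) * ennreal (P (v, z) c) \<partial>lborel) \<le> \<kappa> * 1 * ennreal (P a c)"
      using v bound by (intro nn_integral_comp_bound[OF v]) auto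
    with kmaj_before[OF v, of 0]
    show "(\<integral>\<^sup>+e. kmaj 0 a e * ennreal \<bar>K e c\<bar> * indicator {e. fst e < v} e \<partial>lborel) \<le> \<kappa> * ennreal (P a c)"
      by simp
  qed (auto simp: K_support)
  then show ?thesis by simp
qed

text \<open>The same limit at the starting time: for \<open>e\<close> later than \<open>u\<close>,
  \<open>P a e\<close> is expanded through \<open>u\<close>, so that the one-step bound is used only
  from \<open>u\<close> on.\<close>

lemma kmaj_one_limit_left:
  assumes "fst a < fst c"
    and bound: "\<And>u z. fst a < u \<Longrightarrow> u < fst c \<Longrightarrow> kmaj 1 (u, z) c \<le> \<kappa> * ennreal (P (u, z) c)"
  shows "kmaj 1 a c \<le> \<kappa> * ennreal (P a c)"
proof -
  have "(\<integral>\<^sup>+e. ennreal (P a e) * ennreal \<bar>K e c\<bar> \<partial>lborel) \<le> \<kappa> * ennreal (P a c)"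
  proof (rule nn_integral_le_if_truncated_left[OF _ \<open>fst a < fst c\<close>])
    fix u assume u: "fst a < u" "u < fst c"
    have "(\<integral>\<^sup>+e. ennreal (P a e) * ennreal \<bar>K e c\<bar> * indicator {e. u < fst e} e \<partial>lborel)
        \<le> (\<integral>\<^sup>+e. (\<integral>\<^sup>+z. kmaj 0 a (u, z) * kmaj 0 (u, z) e \<partial>lborel) * ennreal \<bar>K e c\<bar> \<partial>lborel)"
      using u by (intro nn_integral_mono) (auto simp: nn_integral_P_P split: split_indicator)
    also have "\<dots> = (\<integral>\<^sup>+z. kmaj 0 a (u, z) * kmaj 1 (u, z) c \<partial>lborel)"
      by (subst kmaj_after) simp
    also have "\<dots> \<le> 1 * \<kappa> * ennreal (P a c)"
      using u bound by (intro nn_integral_comp_bound[OF u]) auto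
    finally show "(\<integral>\<^sup>+e. ennreal (P a e) * ennreal \<bar>K e c\<bar> * indicator {e. u < fst e} e \<partial>lborel)
        \<le> \<kappa> * ennreal (P a c)" by simp
  qed (auto simp: P_support)
  then show ?thesis by simp
qed

text \<open>Both endpoint limits are combined, so that only values of \<open>Q\<close> strictly
  inside the interval matter. The value \<open>Q (fst a) (fst c)\<close> itself may exceed
  \<theta>.\<close>

lemma kmaj_one_inner_bound:
  assumes "inner_bound \<theta> (fst a) (fst c)"
  shows "kmaj 1 a c \<le> ennreal (\<eta> + \<theta>) * ennreal (P a c)"
proof (cases "fst a < fst c")
  case True
  then show ?thesis
  proof (rule kmaj_one_limit_left)
    fix u z assume u: "fst a < u" "u < fst c"
    show "kmaj 1 (u, z) c \<le> ennreal (\<eta> + \<theta>) * ennreal (P (u, z) c)"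
    proof (rule kmaj_one_limit_right)
      fix v w assume v: "fst (u, z) < v" "v < fst c"
      note kmaj_one_bound
      also have "ennreal (\<eta> + Q (fst (u, z)) (fst (v, w))) * ennreal (P (u, z) (v, w))
          \<le> ennreal (\<eta> + \<theta>) * ennreal (P (u, z) (v, w))"
        using assms u v by (intro mult_right_mono ennreal_leI) (auto simp: inner_bound_def)
      finally show "kmaj 1 (u, z) (v, w) \<le> ennreal (\<eta> + \<theta>) * ennreal (P (u, z) (v, w))" .
    qed (use u in simp)
  qed
qed (simp add: kmaj_support del: kmaj.simps)

lemma kmaj_inner_bound:
  assumes "inner_bound \<theta> (fst a) (fst c)"
  shows "kmaj n a c \<le> ennreal (\<eta> + \<theta>) ^ n * ennreal (P a c)"
  using assms by (intro kmaj_power_bound kmaj_one_inner_bound) (auto simp: inner_bound_def)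

section \<open>Sum of the majorants\<close>

definition kmaj_total :: "real \<times> 'a \<Rightarrow> real \<times> 'a \<Rightarrow> ennreal" where
  "kmaj_total a c = (\<Sum>n. kmaj n a c)"

lemma sum_kmaj_le_total: "(\<Sum>n<N. kmaj n a c) \<le> kmaj_total a c"
  unfolding kmaj_total_def by (rule sum_le_suminf) auto

text \<open>Partial sums suffice: the triangular convolution sum is at most the product of the two
  partial sums under the integral.\<close>

lemma kmaj_total_sub_chapman_kolmogorov:
  assumes "fst a < u" "u < fst c"
  shows "kmaj_total a c \<le> (\<integral>\<^sup>+z. kmaj_total a (u, z) * kmaj_total (u, z) c \<partial>lborel)"
  unfolding kmaj_total_def[of a c]
proof (rule suminf_le_const)
  fix N
  have "(\<Sum>n<N. kmaj n a c) \<le> (\<Sum>n<N. \<Sum>m\<le>n. \<integral>\<^sup>+z. kmaj m a (u, z) * kmaj (n - m) (u, z) c \<partial>lborel)"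
    by (intro sum_mono kmaj_sub_chapman_kolmogorov assms)
  also have "\<dots> = (\<integral>\<^sup>+z. (\<Sum>n<N. \<Sum>m\<le>n. kmaj m a (u, z) * kmaj (n - m) (u, z) c) \<partial>lborel)"
    by (simp add: nn_integral_sum)
  also have "\<dots> \<le> (\<integral>\<^sup>+z. (\<Sum>n<N. kmaj n a (u, z)) * (\<Sum>n<N. kmaj n (u, z) c) \<partial>lborel)"
    by (intro nn_integral_mono sum_triangle_le) auto
  also have "\<dots> \<le> (\<integral>\<^sup>+z. kmaj_total a (u, z) * kmaj_total (u, z) c \<partial>lborel)"
    by (intro nn_integral_mono mult_mono sum_kmaj_le_total) auto
  finally show "(\<Sum>n<N. kmaj n a c) \<le> \<dots>" .
qed auto

lemma kmaj_total_inner_bound: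
  assumes "inner_bound \<theta> (fst a) (fst c)" "0 \<le> \<theta>" "\<eta> + \<theta> < 1"
  shows "kmaj_total a c \<le> ennreal (1 / (1 - (\<eta> + \<theta>))) * ennreal (P a c)"
proof -
  have "kmaj_total a c \<le> (\<Sum>n. ennreal ((\<eta> + \<theta>) ^ n * P a c))"
    unfolding kmaj_total_def
    using kmaj_inner_bound[OF assms(1)] assms \<eta>_nonneg
    by (intro suminf_le) (auto simp: ennreal_mult P_nonneg ennreal_power simp del: ennreal_plus)
  also have "(\<lambda>n. (\<eta> + \<theta>) ^ n * P a c) sums (1 / (1 - (\<eta> + \<theta>)) * P a c)"
    using assms \<eta>_nonneg by (intro sums_mult2 geometric_sums) auto
  then have "(\<Sum>n. ennreal ((\<eta> + \<theta>) ^ n * P a c)) = ennreal (1 / (1 - (\<eta> + \<theta>)) * P a c)"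
    using assms \<eta>_nonneg by (intro suminf_ennreal_eq) (auto simp: P_nonneg)
  also have "\<dots> = ennreal (1 / (1 - (\<eta> + \<theta>))) * ennreal (P a c)"
    using assms by (intro ennreal_mult) (auto simp: P_nonneg)
  finally show ?thesis .
qed

text \<open>Each piece of the interval contributes one geometric series factor \<open>A\<close>, and
  composition multiplies them. Since \<open>A\<close> is at least 1, surplus factors only weaken the
  bound.\<close>

lemma kmaj_total_bound:
  assumes "fst a < fst c" "0 < \<theta>" "\<eta> + \<theta> < 1"
  shows "kmaj_total a c \<le> ennreal ((1 / (1 - (\<eta> + \<theta>))) powr (1 + Q (fst a) (fst c) / \<theta>)) * ennreal (P a c)"
proof -
  define A where "A = 1 / (1 - (\<eta> + \<theta>))"
  have A: "A \<ge> 1" using assms \<eta>_nonneg by (simp add: A_def)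
  obtain n where n: "n \<ge> 1" "real n \<le> 1 + Q (fst a) (fst c) / \<theta>"
      "inner_bound (real n * \<theta>) (fst a) (fst c)"
    using inner_bound_pieces[OF \<open>0 < \<theta>\<close>] .
  let ?R = "\<lambda>n s t. \<forall>x y. kmaj_total (s, x) (t, y) \<le> ennreal (A ^ n) * ennreal (P (s, x) (t, y))"
  have "?R n (fst a) (fst c)"
  proof (rule inner_bound_induct[where R = ?R, OF _ _ _ assms(1) n(1,3)])
    fix s t assume "s < t" "inner_bound \<theta> s t"
    then show "?R 1 s t"
      using kmaj_total_inner_bound assms by (auto simp: A_def)
  next
    fix n s u t assume u: "s < u" "u < t" and R: "?R 1 s u" "?R n u t"
    show "?R (Suc n) s t"
    proof safe
      fix x y
      have "kmaj_total (s, x) (t, y) \<le> (\<integral>\<^sup>+z. kmaj_total (s, x) (u, z) * kmaj_total (u, z) (t, y) \<partial>lborel)"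
        using u by (intro kmaj_total_sub_chapman_kolmogorov) auto
      also have "\<dots> \<le> ennreal (A ^ 1) * ennreal (A ^ n) * ennreal (P (s, x) (t, y))"
        using u R by (intro nn_integral_comp_bound) auto
      finally show "kmaj_total (s, x) (t, y) \<le> ennreal (A ^ Suc n) * ennreal (P (s, x) (t, y))"
        using A by (simp add: ennreal_mult)
    qed
  next
    fix n s t assume R: "?R n s t"
    have "A ^ n \<le> A ^ Suc n" using A by (intro power_increasing) auto
    then have "ennreal (A ^ n) * ennreal (P (s, x) (t, y)) \<le> ennreal (A ^ Suc n) * ennreal (P (s, x) (t, y))" for x y
      by (intro mult_right_mono ennreal_leI) auto
    with R show "?R (Suc n) s t" by (meson order_trans)
  qed
  then have "kmaj_total a c \<le> ennreal (A ^ n) * ennreal (P a c)"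
    by (metis prod.collapse)
  also have "A ^ n \<le> A powr (1 + Q (fst a) (fst c) / \<theta>)"
    using A n powr_mono[OF n(2) A] by (simp add: powr_realpow)
  then have "ennreal (A ^ n) * ennreal (P a c) \<le> ennreal (A powr (1 + Q (fst a) (fst c) / \<theta>)) * ennreal (P a c)"
    by (intro mult_right_mono ennreal_leI) auto
  finally show ?thesis by (simp add: A_def)
qed

section \<open>Chapman-Kolmogorov expansion of the signed terms\<close>

text \<open>This finiteness justifies every application of Fubini to products of signed
  terms.\<close>

lemma kmaj_kmaj_finite:
  assumes "fst a < u" "u < fst c"
  shows "(\<integral>\<^sup>+z. kmaj m a (u, z) * kmaj k (u, z) c \<partial>lborel) < \<infinity>"
proof -
  have "(\<integral>\<^sup>+z. kmaj m a (u, z) * kmaj k (u, z) c \<partial>lborel)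
      \<le> ennreal (\<eta> + Q (fst a) u) ^ m * ennreal (\<eta> + Q u (fst c)) ^ k * ennreal (P a c)"
    using kmaj_bound[of m a "(u, _)"] kmaj_bound[of k "(u, _)" c]
    by (intro nn_integral_comp_bound[OF assms]) auto
  also have "\<dots> < \<infinity>"
    by (simp add: ennreal_mult_less_top power_less_top_ennreal)
  finally show ?thesis .
qed

lemma integrable_kterm_K: "integrable lborel (\<lambda>e. kterm n a e * K e c)"
proof (rule integrableI_bounded)
  have "(\<integral>\<^sup>+e. ennreal (norm (kterm n a e * K e c)) \<partial>lborel) \<le> kmaj (Suc n) a c"
    using kterm_le_kmaj[of n a]
    by (auto simp: abs_mult ennreal_mult intro!: nn_integral_mono mult_right_mono)
  also have "\<dots> \<le> ennreal (\<eta> + Q (fst a) (fst c)) ^ Suc n * ennreal (P a c)"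
    by (rule kmaj_bound)
  also have "\<dots> < \<infinity>"
    by (simp add: ennreal_mult_less_top power_less_top_ennreal del: power_Suc)
  finally show "(\<integral>\<^sup>+e. ennreal (norm (kterm n a e * K e c)) \<partial>lborel) < \<infinity>" .
qed measurable

lemma integrable_kterm_kterm:
  assumes "fst a < u" "u < fst c"
  shows "integrable lborel (\<lambda>z. kterm m a (u, z) * kterm k (u, z) c)"
proof (rule integrableI_bounded)
  have "(\<integral>\<^sup>+z. ennreal (norm (kterm m a (u, z) * kterm k (u, z) c)) \<partial>lborel)
      \<le> (\<integral>\<^sup>+z. kmaj m a (u, z) * kmaj k (u, z) c \<partial>lborel)"
    by (auto simp: abs_mult ennreal_mult intro!: nn_integral_mono mult_mono kterm_le_kmaj)
  with kmaj_kmaj_finite[OF assms, of m k]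
  show "(\<integral>\<^sup>+z. ennreal (norm (kterm m a (u, z) * kterm k (u, z) c)) \<partial>lborel) < \<infinity>"
    by (rule order_le_less_trans[rotated])
qed measurable

text \<open>Signed counterpart of \<open>kmaj_before\<close>, now an equality because
  \<open>K_P\<close> is used without absolute values.\<close>

lemma kterm_before:
  assumes "fst a < u" "u < fst c"
  shows "(LINT e|lborel. indicator {e. fst e < u} e * (kterm n a e * K e c))
    = (LINT z|lborel. kterm (Suc n) a (u, z) * P (u, z) c)"
proof -
  let ?f = "\<lambda>e z. kterm n a e * K e (u, z) * P (u, z) c"
  have "integrable (lborel \<Otimes>\<^sub>M lborel) (case_prod ?f)"
  proof (rule integrableI_bounded)
    have "(\<integral>\<^sup>+x. ennreal (norm (case_prod ?f x)) \<partial>(lborel \<Otimes>\<^sub>M lborel))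
        = (\<integral>\<^sup>+z. (\<integral>\<^sup>+e. ennreal (norm (?f e z)) \<partial>lborel) \<partial>lborel)"
      by (subst lborel_pair.nn_integral_snd[symmetric]) auto
    also have "\<dots> \<le> (\<integral>\<^sup>+z. (\<integral>\<^sup>+e. kmaj n a e * ennreal \<bar>K e (u, z)\<bar> * ennreal (P (u, z) c) \<partial>lborel) \<partial>lborel)"
      by (intro nn_integral_mono)
        (auto simp: abs_mult ennreal_mult P_nonneg intro!: mult_right_mono kterm_le_kmaj)
    also have "\<dots> = (\<integral>\<^sup>+z. kmaj (Suc n) a (u, z) * kmaj 0 (u, z) c \<partial>lborel)"
      by (simp add: nn_integral_multc)
    also have "\<dots> < \<infinity>" by (rule kmaj_kmaj_finite[OF assms])
    finally show "(\<integral>\<^sup>+x. ennreal (norm (case_prod ?f x)) \<partial>(lborel \<Otimes>\<^sub>M lborel)) < \<infinity>" .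
  qed measurable
  note swap = lborel_pair.Fubini_integral[OF this]
  \<comment> \<open>The indicator arises by itself: \<open>K e (u, z)\<close> vanishes when
    \<open>e\<close> is not before \<open>u\<close>.\<close>
  have "(LINT z|lborel. ?f e z) = indicator {e. fst e < u} e * (kterm n a e * K e c)" for e
  proof (cases "fst e < u")
    case True
    with K_P[OF True assms(2)] show ?thesis
      by (simp add: has_bochner_integral_iff mult.assoc)
  qed (simp add: K_support)
  moreover have "(LINT e|lborel. ?f e z) = kterm (Suc n) a (u, z) * P (u, z) c" for z
    by simp
  ultimately show ?thesis using swap by simp
qed

lemma kterm_after:
  assumes "fst a < u" "u < fst c"
  shows "(LINT e|lborel. (LINT z|lborel. kterm m a (u, z) * kterm k (u, z) e) * K e c)
    = (LINT z|lborel. kterm m a (u, z) * kterm (Suc k) (u, z) c)"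
    and "integrable lborel (\<lambda>e. (LINT z|lborel. kterm m a (u, z) * kterm k (u, z) e) * K e c)"
proof -
  let ?f = "\<lambda>e z. kterm m a (u, z) * kterm k (u, z) e * K e c"
  have int: "integrable (lborel \<Otimes>\<^sub>M lborel) (case_prod ?f)"
  proof (rule integrableI_bounded)
    have "(\<integral>\<^sup>+x. ennreal (norm (case_prod ?f x)) \<partial>(lborel \<Otimes>\<^sub>M lborel))
        = (\<integral>\<^sup>+z. (\<integral>\<^sup>+e. ennreal (norm (?f e z)) \<partial>lborel) \<partial>lborel)"
      by (subst lborel_pair.nn_integral_snd[symmetric]) auto
    also have "\<dots> \<le> (\<integral>\<^sup>+z. (\<integral>\<^sup>+e. kmaj m a (u, z) * (kmaj k (u, z) e * ennreal \<bar>K e c\<bar>) \<partial>lborel) \<partial>lborel)"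
      by (intro nn_integral_mono)
        (auto simp: abs_mult ennreal_mult mult.assoc intro!: mult_mono kterm_le_kmaj)
    also have "\<dots> = (\<integral>\<^sup>+z. kmaj m a (u, z) * kmaj (Suc k) (u, z) c \<partial>lborel)"
      by (simp add: nn_integral_cmult)
    also have "\<dots> < \<infinity>" by (rule kmaj_kmaj_finite[OF assms])
    finally show "(\<integral>\<^sup>+x. ennreal (norm (case_prod ?f x)) \<partial>(lborel \<Otimes>\<^sub>M lborel)) < \<infinity>" .
  qed measurable
  have inner: "(LINT z|lborel. ?f e z) = (LINT z|lborel. kterm m a (u, z) * kterm k (u, z) e) * K e c" for e
    by simp
  have "(LINT e|lborel. ?f e z) = kterm m a (u, z) * kterm (Suc k) (u, z) c" for z
    by (simp add: mult.assoc)
  with lborel_pair.Fubini_integral[OF int] inner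
  show "(LINT e|lborel. (LINT z|lborel. kterm m a (u, z) * kterm k (u, z) e) * K e c)
    = (LINT z|lborel. kterm m a (u, z) * kterm (Suc k) (u, z) c)" by simp
  show "integrable lborel (\<lambda>e. (LINT z|lborel. kterm m a (u, z) * kterm k (u, z) e) * K e c)"
    using lborel_pair.integrable_fst[OF int] unfolding inner .
qed

text \<open>The induction of \<open>kmaj_sub_chapman_kolmogorov\<close> with equalities
  throughout.\<close>

lemma kterm_chapman_kolmogorov:
  assumes "fst a < u" "u < fst c"
  shows "kterm n a c = (\<Sum>m\<le>n. LINT z|lborel. kterm m a (u, z) * kterm (n - m) (u, z) c)"
  using assms(2)
proof (induction n arbitrary: c)
  case 0
  then show ?case using P_P[OF assms(1), of c] by (simp add: has_bochner_integral_iff)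
next
  case (Suc n)
  note fst_borel_measurable [measurable]
  let ?F = "\<lambda>e. kterm n a e * K e c"
  let ?G = "\<lambda>m e. (LINT z|lborel. kterm m a (u, z) * kterm (n - m) (u, z) e) * K e c"
  have "integrable lborel (\<lambda>e. indicator {e. fst e < u} e *\<^sub>R ?F e)"
    by (intro integrable_mult_indicator integrable_kterm_K) simp
  moreover have "integrable lborel (\<lambda>e. \<Sum>m\<le>n. ?G m e)"
    by (intro Bochner_Integration.integrable_sum kterm_after(2) assms Suc.prems)
  moreover have "kterm (Suc n) a c
      = (LINT e|lborel. indicator {e. fst e < u} e * ?F e + (\<Sum>m\<le>n. ?G m e))"
    unfolding kterm.simps
  proof (rule integral_cong_AE)
    show "AE e in lborel. ?F e = indicator {e. fst e < u} e * ?F e + (\<Sum>m\<le>n. ?G m e)"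
      using AE_lborel_fst_neq[of u]
    proof eventually_elim
      case (elim e)
      show ?case
      proof (cases "fst e < u")
        case True
        \<comment> \<open>For \<open>e\<close> before \<open>u\<close> every
          \<open>kterm (n - m) (u, z) e\<close> vanishes, so the sum over \<open>m\<close>
          contributes only at later times and carries no indicator.\<close>
        then show ?thesis by (simp add: kterm_support)
      next
        case False
        with elim have "u < fst e" by simp
        from Suc.IH[OF this] False show ?thesis by (simp add: sum_distrib_right)
      qed
    qed
  qed measurable
  ultimately have "kterm (Suc n) a c = (LINT e|lborel. indicator {e. fst e < u} e * ?F e)
      + (\<Sum>m\<le>n. LINT e|lborel. ?G m e)"
    using kterm_after(2)[OF assms(1) Suc.prems]
    by (simp add: Bochner_Integration.integral_add Bochner_Integration.integral_sum)
  also have "\<dots> = (LINT z|lborel. kterm (Suc n) a (u, z) * P (u, z) c)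
      + (\<Sum>m\<le>n. LINT z|lborel. kterm m a (u, z) * kterm (Suc n - m) (u, z) c)"
    unfolding kterm_before[OF assms(1) Suc.prems] kterm_after(1)[OF assms(1) Suc.prems]
    by (intro arg_cong2[where f = "(+)"] sum.cong) (auto simp: Suc_diff_le)
  finally show ?case by simp
qed

section \<open>Convergence and Chapman-Kolmogorov equation of the series\<close>

definition kseries :: "real \<times> 'a \<Rightarrow> real \<times> 'a \<Rightarrow> real" where
  "kseries a c = (\<Sum>n. kterm n a c)"

lemma measurable_kseries [measurable (raw)]:
  "f \<in> borel_measurable M \<Longrightarrow> g \<in> borel_measurable M \<Longrightarrow> (\<lambda>x. kseries (f x) (g x)) \<in> borel_measurable M"
  unfolding kseries_def by measurable

lemma sum_kterm_le:
  assumes "kmaj_total a c \<le> ennreal B * ennreal (P a c)" "0 \<le> B"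
  shows "(\<Sum>n<N. \<bar>kterm n a c\<bar>) \<le> B * P a c"
proof -
  have "ennreal (\<Sum>n<N. \<bar>kterm n a c\<bar>) = (\<Sum>n<N. ennreal \<bar>kterm n a c\<bar>)"
    by (rule sum_ennreal[symmetric]) simp
  also have "\<dots> \<le> (\<Sum>n<N. kmaj n a c)"
    by (intro sum_mono kterm_le_kmaj)
  also have "\<dots> \<le> ennreal (B * P a c)"
    using assms sum_kmaj_le_total[of a c N] by (simp add: ennreal_mult P_nonneg)
  finally show ?thesis using assms P_nonneg by simp
qed

lemma summable_kterm:
  assumes "kmaj_total a c \<le> ennreal B * ennreal (P a c)" "0 \<le> B"
  shows "summable (\<lambda>n. \<bar>kterm n a c\<bar>)"
  using sum_kterm_le[OF assms] by (intro bounded_imp_summable[where B = "B * P a c"]) (auto simp only: lessThan_Suc_atMost[symmetric] abs_ge_zero)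

lemma kseries_le:
  assumes "kmaj_total a c \<le> ennreal B * ennreal (P a c)" "0 \<le> B"
  shows "kseries a c \<le> B * P a c"
proof -
  have "kseries a c \<le> (\<Sum>n. \<bar>kterm n a c\<bar>)"
    unfolding kseries_def using summable_kterm[OF assms]
    by (intro suminf_le) (auto intro: summable_rabs_cancel)
  also have "\<dots> \<le> B * P a c"
    by (intro suminf_le_const summable_kterm[OF assms] sum_kterm_le[OF assms])
  finally show ?thesis .
qed

text \<open>The product of the two series is a Cauchy product, whose partial sums integrate to
  partial sums of \<open>kseries a c\<close> by the expansion of the terms. Dominated convergence
  passes to the limit.\<close>

lemma kseries_chapman_kolmogorov:
  assumes "\<eta> < 1" "fst a < u" "u < fst c"
  shows "has_bochner_integral lborel (\<lambda>z. kseries a (u, z) * kseries (u, z) c) (kseries a c)"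
proof -
  \<comment> \<open>Half of the room below 1, so that \<eta> + \<theta> stays below 1.\<close>
  define \<theta> where "\<theta> = (1 - \<eta>) / 2"
  have \<theta>: "0 < \<theta>" "\<eta> + \<theta> < 1" using assms(1) by (auto simp: \<theta>_def field_simps)
  define A where "A s t = (1 / (1 - (\<eta> + \<theta>))) powr (1 + Q s t / \<theta>)" for s t
  have A: "0 \<le> A s t" for s t by (simp add: A_def)
  have total: "kmaj_total a c \<le> ennreal (A (fst a) (fst c)) * ennreal (P a c)" if "fst a < fst c" for a c
    using kmaj_total_bound[OF that \<theta>] by (simp add: A_def)
  have total_a: "kmaj_total a (u, z) \<le> ennreal (A (fst a) u) * ennreal (P a (u, z))"
    and total_c: "kmaj_total (u, z) c \<le> ennreal (A u (fst c)) * ennreal (P (u, z) c)" for z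
    using total[of a "(u, z)"] total[of "(u, z)" c] assms by auto
  let ?s = "\<lambda>N z. \<Sum>n<N. \<Sum>m\<le>n. kterm m a (u, z) * kterm (n - m) (u, z) c"
  \<comment> \<open>The total majorants make a constant multiple of the Chapman-Kolmogorov integrand
    of \<open>P\<close> a dominating function.\<close>
  let ?w = "\<lambda>z. A (fst a) u * A u (fst c) * (P a (u, z) * P (u, z) c)"
  have w: "integrable lborel ?w"
    using P_P[OF assms(2,3)] by (auto simp: has_bochner_integral_iff)
  have lim: "AE z in lborel. (\<lambda>N. ?s N z) \<longlonglongrightarrow> kseries a (u, z) * kseries (u, z) c"
  proof (rule AE_I2)
    fix z
    show "(\<lambda>N. ?s N z) \<longlonglongrightarrow> kseries a (u, z) * kseries (u, z) c"
      using Cauchy_product_sums[of "\<lambda>n. kterm n a (u, z)" "\<lambda>n. kterm n (u, z) c"]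
        summable_kterm[OF total_a A] summable_kterm[OF total_c A]
      by (simp add: sums_def kseries_def)
  qed
  have bound: "AE z in lborel. norm (?s N z) \<le> ?w z" for N
  proof (rule AE_I2)
    fix z
    have "norm (?s N z) \<le> (\<Sum>n<N. \<Sum>m\<le>n. \<bar>kterm m a (u, z)\<bar> * \<bar>kterm (n - m) (u, z) c\<bar>)"
      by (auto simp: abs_mult[symmetric] intro!: order_trans[OF sum_abs] sum_mono)
    also have "\<dots> \<le> (\<Sum>n<N. \<bar>kterm n a (u, z)\<bar>) * (\<Sum>n<N. \<bar>kterm n (u, z) c\<bar>)"
      by (rule sum_triangle_le) auto
    also have "\<dots> \<le> (A (fst a) u * P a (u, z)) * (A u (fst c) * P (u, z) c)"
      using A by (intro mult_mono sum_kterm_le total_a total_c) (auto simp: P_nonneg sum_nonneg)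
    finally show "norm (?s N z) \<le> ?w z" by (simp add: ac_simps)
  qed
  have meas: "(\<lambda>z. kseries a (u, z) * kseries (u, z) c) \<in> borel_measurable lborel"
    "?s N \<in> borel_measurable lborel" for N by measurable
  have "(LINT z|lborel. ?s N z) = (\<Sum>n<N. kterm n a c)" for N
    using integrable_kterm_kterm[OF assms(2,3)]
    by (simp add: Bochner_Integration.integral_sum Bochner_Integration.integrable_sum
        kterm_chapman_kolmogorov[OF assms(2,3)])
  then have "(\<lambda>N. LINT z|lborel. ?s N z) \<longlonglongrightarrow> kseries a c"
    using summable_LIMSEQ[OF summable_rabs_cancel[OF summable_kterm[OF total A]]] assms
    by (simp add: kseries_def)
  moreover have "(\<lambda>N. LINT z|lborel. ?s N z) \<longlonglongrightarrow> (LINT z|lborel. kseries a (u, z) * kseries (u, z) c)"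
    by (rule integral_dominated_convergence[OF meas w lim bound])
  ultimately show ?thesis
    using integrable_dominated_convergence[OF meas w lim bound] LIMSEQ_unique
    by (auto simp: has_bochner_integral_iff)
qed

section \<open>Lower and upper bounds for the series\<close>

text \<open>With \<kappa> = \<eta> + \<theta>, the terms after the zeroth have absolute sum at most
  \<open>\<kappa> / (1 - \<kappa>) * P a c\<close>, which is subtracted from \<open>P a c\<close>.
  The resulting factor is positive exactly for \<kappa> < 1/2.\<close>

lemma kseries_inner_bound:
  assumes "inner_bound \<theta> (fst a) (fst c)" "0 \<le> \<theta>" "\<eta> + \<theta> < 1"
  shows "(1 - 2 * (\<eta> + \<theta>)) / (1 - (\<eta> + \<theta>)) * P a c \<le> kseries a c"
proof -
  define \<kappa> where "\<kappa> = \<eta> + \<theta>"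
  have \<kappa>: "0 \<le> \<kappa>" "\<kappa> < 1" using assms \<eta>_nonneg by (auto simp: \<kappa>_def)
  have le: "\<bar>kterm n a c\<bar> \<le> \<kappa> ^ n * P a c" for n
  proof -
    have "ennreal \<bar>kterm n a c\<bar> \<le> ennreal (\<kappa> ^ n * P a c)"
      using order_trans[OF kterm_le_kmaj kmaj_inner_bound[OF assms(1)]] \<kappa>
      by (simp add: ennreal_mult ennreal_power P_nonneg \<kappa>_def)
    then show ?thesis using \<kappa> by (simp add: P_nonneg)
  qed
  have geo: "(\<lambda>n. \<kappa> ^ n * P a c) sums (1 / (1 - \<kappa>) * P a c)"
    using \<kappa> by (intro sums_mult2 geometric_sums) auto
  have sm: "summable (\<lambda>n. kterm n a c)"
    using le by (intro summable_comparison_test'[OF sums_summable[OF geo]]) auto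
  \<comment> \<open>Adding the geometric majorant makes all summands nonnegative, so the sum is at
    least its zeroth summand \<open>2 * P a c\<close>.\<close>
  have "(\<lambda>n. kterm n a c + \<kappa> ^ n * P a c) sums (kseries a c + 1 / (1 - \<kappa>) * P a c)"
    unfolding kseries_def by (intro sums_add summable_sums sm geo)
  moreover have "0 \<le> kterm n a c + \<kappa> ^ n * P a c" for n
    using le[of n] by linarith
  ultimately have "(\<Sum>n\<in>{0}. kterm n a c + \<kappa> ^ n * P a c) \<le> kseries a c + 1 / (1 - \<kappa>) * P a c"
    using sum_le_suminf[of "\<lambda>n. kterm n a c + \<kappa> ^ n * P a c" "{0}"] by (simp add: sums_iff)
  then have "(2 - 1 / (1 - \<kappa>)) * P a c \<le> kseries a c"
    by (simp add: algebra_simps)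
  also have "2 - 1 / (1 - \<kappa>) = (1 - 2 * \<kappa>) / (1 - \<kappa>)"
    using \<kappa> by (simp add: field_simps)
  finally show ?thesis by (simp add: \<kappa>_def)
qed

text \<open>Since \<open>B\<close> is positive, lower bounds on adjacent pieces may be multiplied
  under the Chapman-Kolmogorov integral of the series. Since \<open>B\<close> is at most 1, surplus
  factors only weaken them.\<close>

lemma kseries_lower_bound:
  assumes "fst a < fst c" "0 < \<theta>" "\<eta> + \<theta> < 1 / 2"
  shows "((1 - 2 * (\<eta> + \<theta>)) / (1 - (\<eta> + \<theta>))) powr (1 + Q (fst a) (fst c) / \<theta>) * P a c \<le> kseries a c"
proof -
  define B where "B = (1 - 2 * (\<eta> + \<theta>)) / (1 - (\<eta> + \<theta>))"
  have B: "0 < B" "B \<le> 1" using assms \<eta>_nonneg by (auto simp: B_def field_simps)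
  obtain n where n: "n \<ge> 1" "real n \<le> 1 + Q (fst a) (fst c) / \<theta>"
      "inner_bound (real n * \<theta>) (fst a) (fst c)"
    using inner_bound_pieces[OF \<open>0 < \<theta>\<close>] .
  let ?R = "\<lambda>n s t. \<forall>x y. B ^ n * P (s, x) (t, y) \<le> kseries (s, x) (t, y)"
  have "?R n (fst a) (fst c)"
  proof (rule inner_bound_induct[where R = ?R, OF _ _ _ assms(1) n(1,3)])
    fix s t assume "s < t" "inner_bound \<theta> s t"
    then show "?R 1 s t"
      using kseries_inner_bound assms by (auto simp: B_def)
  next
    fix n s u t assume u: "s < u" "u < t" and R: "?R 1 s u" "?R n u t"
    show "?R (Suc n) s t"
    proof safe
      fix x y
      have CK: "has_bochner_integral lborel (\<lambda>z. kseries (s, x) (u, z) * kseries (u, z) (t, y)) (kseries (s, x) (t, y))"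
        using u assms by (intro kseries_chapman_kolmogorov) auto
      have PP: "has_bochner_integral lborel (\<lambda>z. B ^ Suc n * (P (s, x) (u, z) * P (u, z) (t, y))) (B ^ Suc n * P (s, x) (t, y))"
        using u by (intro has_bochner_integral_mult_right P_P) auto
      have "(LINT z|lborel. B ^ Suc n * (P (s, x) (u, z) * P (u, z) (t, y)))
          \<le> (LINT z|lborel. kseries (s, x) (u, z) * kseries (u, z) (t, y))"
      proof (rule integral_mono)
        fix z
        have "(B ^ 1 * P (s, x) (u, z)) * (B ^ n * P (u, z) (t, y)) \<le> kseries (s, x) (u, z) * kseries (u, z) (t, y)"
          using R B by (intro mult_mono') (auto simp: P_nonneg)
        then show "B ^ Suc n * (P (s, x) (u, z) * P (u, z) (t, y)) \<le> kseries (s, x) (u, z) * kseries (u, z) (t, y)"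
          by (simp add: ac_simps)
      qed (use PP CK in \<open>auto simp: has_bochner_integral_iff\<close>)
      with PP CK show "B ^ Suc n * P (s, x) (t, y) \<le> kseries (s, x) (t, y)"
        by (simp only: has_bochner_integral_iff)
    qed
  next
    fix n s t assume R: "?R n s t"
    have "B ^ Suc n \<le> B ^ n" using B by (intro power_decreasing) auto
    then have "B ^ Suc n * P (s, x) (t, y) \<le> B ^ n * P (s, x) (t, y)" for x y
      by (intro mult_right_mono) (auto simp: P_nonneg)
    with R show "?R (Suc n) s t" by (meson order_trans)
  qed
  then have "B ^ n * P a c \<le> kseries a c"
    by (metis prod.collapse)
  moreover have "B powr (1 + Q (fst a) (fst c) / \<theta>) \<le> B ^ n"
    using B powr_mono'[OF n(2), of B] by (simp add: powr_realpow)
  then have "B powr (1 + Q (fst a) (fst c) / \<theta>) * P a c \<le> B ^ n * P a c"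
    by (intro mult_right_mono) (auto simp: P_nonneg)
  ultimately show ?thesis by (simp add: B_def)
qed

lemma kseries_upper_bound:
  assumes "fst a < fst c" "\<eta> < 1 / 2"
  shows "kseries a c \<le> P a c *
    (if \<eta> = 0 then exp (Q (fst a) (fst c)) else (1 / (1 - 2 * \<eta>)) powr (1 + Q (fst a) (fst c) / \<eta>))"
proof -
  define q where "q = Q (fst a) (fst c)"
  have bound: "kseries a c \<le> (1 / (1 - (\<eta> + \<theta>))) powr (1 + q / \<theta>) * P a c"
    if "0 < \<theta>" "\<eta> + \<theta> < 1" for \<theta>
    unfolding q_def by (rule kseries_le[OF kmaj_total_bound[OF assms(1) that]]) simp
  show ?thesis
  proof (cases "\<eta> = 0")
    case True
    \<comment> \<open>For \<eta> = 0 the bound holds for every \<theta> between 0 and 1. Its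
      logarithm is \<open>- (1 + q / \<theta>) * ln (1 - \<theta>)\<close>, which tends to
      \<open>q\<close>.\<close>
    have "((\<lambda>\<theta>::real. (1 / (1 - \<theta>)) powr (1 + q / \<theta>)) \<longlongrightarrow> exp q) (at_right 0)"
      by real_asymp
    then have "((\<lambda>\<theta>::real. (1 / (1 - \<theta>)) powr (1 + q / \<theta>) * P a c) \<longlongrightarrow> exp q * P a c) (at_right 0)"
      by (intro tendsto_mult tendsto_const)
    moreover have "eventually (\<lambda>\<theta>. kseries a c \<le> (1 / (1 - \<theta>)) powr (1 + q / \<theta>) * P a c) (at_right 0)"
      using bound True eventually_at_right_real[of 0 1] by (auto elim!: eventually_mono)
    ultimately have "kseries a c \<le> exp q * P a c"
      by (rule tendsto_lowerbound) simp
    with True show ?thesis by (simp add: q_def mult.commute)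
  next
    case False
    \<comment> \<open>The choice \<theta> = \<eta> is admissible because \<eta> < 1/2.\<close>
    with bound[of \<eta>] assms(2) \<eta>_nonneg show ?thesis by (simp add: q_def mult.commute)
  qed
qed

lemma kseries_lower_bound_uniform:
  assumes "\<eta> < 1 / 2"
  obtains C where "C > 1"
    "\<And>a c. fst a < fst c \<Longrightarrow> P a c / C powr (1 + Q (fst a) (fst c)) \<le> kseries a c"
proof -
  \<comment> \<open>Half of the room below 1/2, which keeps the base \<open>B\<close>
    positive.\<close>
  define \<theta> where "\<theta> = (1 / 2 - \<eta>) / 2"
  have \<theta>: "0 < \<theta>" "\<eta> + \<theta> < 1 / 2" using assms by (auto simp: \<theta>_def field_simps)
  define B where "B = (1 - 2 * (\<eta> + \<theta>)) / (1 - (\<eta> + \<theta>))"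
  have B: "0 < B" "B \<le> 1" using \<theta> \<eta>_nonneg by (auto simp: B_def field_simps)
  define L where "L = - ln B"
  have L: "0 \<le> L" using B by (simp add: L_def)
  \<comment> \<open>On the logarithmic scale the claim is
    \<open>L * (1 + q / \<theta>) \<le> (1 + q) * ln C\<close> for all nonnegative \<open>q\<close>.
    The coefficient \<open>L * (1 + 1 / \<theta>)\<close> achieves this, and the added 1 ensures
    \<open>C > 1\<close>.\<close>
  define C where "C = exp (1 + L * (1 + 1 / \<theta>))"
  have "C > 1" using L \<theta> by (simp add: C_def add_pos_nonneg)
  moreover have "P a c / C powr (1 + Q (fst a) (fst c)) \<le> kseries a c" if "fst a < fst c" for a c
  proof -
    define q where "q = Q (fst a) (fst c)"
    have q: "0 \<le> q" by (simp add: q_def Q_nonneg)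
    have "L * (1 + q / \<theta>) \<le> (1 + q) * (1 + L * (1 + 1 / \<theta>))"
    proof -
      have "(1 + q) * (1 + L * (1 + 1 / \<theta>)) - L * (1 + q / \<theta>) = 1 + q + L / \<theta> + q * L"
        by (simp add: algebra_simps add_divide_distrib)
      moreover have "0 \<le> 1 + q + L / \<theta> + q * L" using q L \<theta> by simp
      ultimately show ?thesis by (metis diff_ge_0_iff_ge)
    qed
    then have "1 / C powr (1 + q) \<le> B powr (1 + q / \<theta>)"
      using B by (simp add: C_def L_def powr_def exp_minus[symmetric] inverse_eq_divide[symmetric] mult.commute)
    then have "1 / C powr (1 + q) * P a c \<le> B powr (1 + q / \<theta>) * P a c"
      by (intro mult_right_mono) (auto simp: P_nonneg)
    also have "\<dots> \<le> kseries a c"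
      using kseries_lower_bound[OF that \<theta>] by (simp add: B_def q_def)
    finally show ?thesis by (simp add: q_def)
  qed
  ultimately show ?thesis by (rule that)
qed

end

section \<open>Measurability of the gradient kernel\<close>

lemma deriv_LIMSEQ:
  fixes f :: "real \<Rightarrow> real"
  assumes "f differentiable (at 0)"
  shows "(\<lambda>n. (f (inverse (real (Suc n))) - f 0) / inverse (real (Suc n))) \<longlonglongrightarrow> deriv f 0"
proof -
  have "(f has_real_derivative deriv f 0) (at 0)"
    using assms DERIV_deriv_iff_real_differentiable by blast
  then have "((\<lambda>h. (f (0 + h) - f 0) / h) \<longlongrightarrow> deriv f 0) (at 0)"
    by (simp add: DERIV_def)
  moreover have "filterlim (\<lambda>n. inverse (real (Suc n))) (at 0) sequentially"
    by (intro filterlim_atI LIMSEQ_inverse_real_of_nat) simp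
  ultimately show ?thesis
    by (auto dest: filterlim_compose)
qed

text \<open>Each partial derivative is a pointwise limit of difference quotients of \<open>p\<close>
  along the steps \<open>1 / (n + 1)\<close>, and these are Borel in all variables. Both kernels are
  cut to 0 off the ordered times, since the gradient is known to exist only there.\<close>

lemma measurable_drift_kernel:
  fixes p :: "real \<Rightarrow> real^'d \<Rightarrow> real \<Rightarrow> real^'d \<Rightarrow> real"
    and b :: "real \<Rightarrow> real^'d \<Rightarrow> real^'d"
  assumes p_borel: "(\<lambda>(s, x, t, y). p s x t y) \<in> borel_measurable borel"
    and b_borel: "(\<lambda>(u, z). b u z) \<in> borel_measurable borel"
    and grad_p_exists: "\<And>s t x y. s < t \<Longrightarrow> grad_exists (\<lambda>w. p s w t y) x"
  shows "(\<lambda>((u, z), (t, y)). if u < t then p u z t y else 0) \<in> borel_measurable (borel \<Otimes>\<^sub>M borel)"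
    and "(\<lambda>((u, z), (t, y)). if u < t then b u z \<bullet> grad (\<lambda>w. p u w t y) z else 0)
      \<in> borel_measurable (borel \<Otimes>\<^sub>M borel)"
proof -
  let ?M = "borel \<Otimes>\<^sub>M borel :: ((real \<times> (real^'d)) \<times> (real \<times> (real^'d))) measure"
  have [measurable]: "fst \<in> borel_measurable (borel :: (real \<times> (real^'d)) measure)"
    "snd \<in> borel_measurable (borel :: (real \<times> (real^'d)) measure)"
    by (intro borel_measurable_continuous_onI continuous_intros)+
  have p [measurable (raw)]: "(\<lambda>e. p (f1 e) (f2 e) (f3 e) (f4 e)) \<in> borel_measurable ?M"
    if [measurable]: "f1 \<in> borel_measurable ?M" "f2 \<in> borel_measurable ?M"
      "f3 \<in> borel_measurable ?M" "f4 \<in> borel_measurable ?M" for f1 f2 f3 f4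
  proof -
    have "(\<lambda>e. (f1 e, f2 e, f3 e, f4 e)) \<in> borel_measurable ?M" by measurable
    from measurable_compose[OF this p_borel] show ?thesis by simp
  qed
  have b [measurable]: "(\<lambda>e. b (fst (fst e)) (snd (fst e))) \<in> borel_measurable ?M"
    using measurable_compose[OF measurable_fst b_borel] by (simp add: case_prod_beta)
  show "(\<lambda>((u, z), (t, y)). if u < t then p u z t y else 0) \<in> borel_measurable ?M"
    unfolding case_prod_beta by measurable
  have grad [measurable]: "(\<lambda>e. if fst (fst e) < fst (snd e)
      then grad (\<lambda>w. p (fst (fst e)) w (fst (snd e)) (snd (snd e))) (snd (fst e)) $ i else 0)
      \<in> borel_measurable ?M" (is "?g \<in> _") for i
  proof (rule borel_measurable_LIMSEQ_real)
    let ?q = "\<lambda>n e. if fst (fst e) < fst (snd e) then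
      (p (fst (fst e)) (snd (fst e) + inverse (real (Suc n)) *\<^sub>R axis i 1) (fst (snd e)) (snd (snd e))
        - p (fst (fst e)) (snd (fst e)) (fst (snd e)) (snd (snd e))) / inverse (real (Suc n)) else 0"
    show "?q n \<in> borel_measurable ?M" for n by measurable
    show "(\<lambda>n. ?q n e) \<longlonglongrightarrow> ?g e" for e
    proof (cases "fst (fst e) < fst (snd e)")
      case True
      with grad_p_exists[OF True, of "snd (snd e)" "snd (fst e)"] show ?thesis
        unfolding grad_exists_def by (auto simp: grad_def dest!: spec[of _ i] deriv_LIMSEQ)
    qed simp
  qed
  have "(\<lambda>e. \<Sum>i\<in>UNIV. b (fst (fst e)) (snd (fst e)) $ i * (if fst (fst e) < fst (snd e)
      then grad (\<lambda>w. p (fst (fst e)) w (fst (snd e)) (snd (snd e))) (snd (fst e)) $ i else 0))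
      \<in> borel_measurable ?M"
    by (intro borel_measurable_sum borel_measurable_times grad measurable_compose[OF b]
        borel_measurable_continuous_onI continuous_intros)
  also have "(\<lambda>e. \<Sum>i\<in>UNIV. b (fst (fst e)) (snd (fst e)) $ i * (if fst (fst e) < fst (snd e)
      then grad (\<lambda>w. p (fst (fst e)) w (fst (snd e)) (snd (snd e))) (snd (fst e)) $ i else 0))
    = (\<lambda>((u, z), (t, y)). if u < t then b u z \<bullet> grad (\<lambda>w. p u w t y) z else 0)"
    by (auto simp: fun_eq_iff inner_vec_def)
  finally show "(\<lambda>((u, z), (t, y)). if u < t then b u z \<bullet> grad (\<lambda>w. p u w t y) z else 0)
      \<in> borel_measurable ?M" .
qed

section \<open>Passage between the given kernel and the space-time kernels\<close>

theorem theorem1: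
  fixes p :: "real \<Rightarrow> real^'d \<Rightarrow> real \<Rightarrow> real^'d \<Rightarrow> real"
    and b :: "real \<Rightarrow> real^'d \<Rightarrow> real^'d"
    and Q :: "real \<Rightarrow> real \<Rightarrow> real"
    and \<eta> :: real
  assumes p_borel: "(\<lambda>(s, x, t, y). p s x t y) \<in> borel_measurable borel"
    and b_borel: "(\<lambda>(u, z). b u z) \<in> borel_measurable borel"
    and p_nonneg: "\<And>s x t y. 0 \<le> p s x t y"
    and chapman_kolmogorov: "\<And>s u t x y. s < u \<Longrightarrow> u < t \<Longrightarrow>
      has_bochner_integral lborel (\<lambda>z. p s x u z * p u z t y) (p s x t y)"
    and grad_p_exists: "\<And>s t x y. s < t \<Longrightarrow> grad_exists (\<lambda>w. p s w t y) x"
    and grad_p_integral: "\<And>s u t x y. s < u \<Longrightarrow> u < t \<Longrightarrow>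
      has_bochner_integral lborel (\<lambda>z. p u z t y *\<^sub>R grad (\<lambda>w. p s w u z) x)
        (grad (\<lambda>w. p s w t y) x)"
    and eta: "0 \<le> \<eta>" "\<eta> < 1 / 2"
    and Q_nonneg: "\<And>r v. 0 \<le> Q r v"
    and Q_superadditive: "\<And>r u v. r < u \<Longrightarrow> u < v \<Longrightarrow> Q r u + Q u v \<le> Q r v"
    and b_N: "b \<in> class_N \<eta> Q p"
  shows "(\<forall>s t x y. s < t \<longrightarrow> summable (\<lambda>n. \<bar>pert_term p b n s x t y\<bar>)) \<and>
    (\<exists>C>1. \<forall>s t x y. s < t \<longrightarrow>
       p s x t y / C powr (1 + Q s t) \<le> pert_series p b s x t y \<and>
       pert_series p b s x t y \<le> p s x t y *
         (if \<eta> = 0 then exp (Q s t) else (1 / (1 - 2 * \<eta>)) powr (1 + Q s t / \<eta>))) \<and>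
    (\<forall>s u t x y. s < u \<and> u < t \<longrightarrow>
       has_bochner_integral lborel (\<lambda>z. pert_series p b s x u z * pert_series p b u z t y)
         (pert_series p b s x t y))"
proof -
  define P where "P = (\<lambda>(s, x) (t, y). if s < t then p s x t y else 0)"
  define K where "K = (\<lambda>(u, z) (t, y). if u < t then b u z \<bullet> grad (\<lambda>w. p u w t y) z else 0)"
  have P_simp: "P (s, x) (t, y) = (if s < t then p s x t y else 0)" for s x t y
    by (simp add: P_def)
  have K_simp: "K (u, z) (t, y) = (if u < t then b u z \<bullet> grad (\<lambda>w. p u w t y) z else 0)" for u z t y
    by (simp add: K_def)
  have P_measurable: "case_prod P \<in> borel_measurable (borel \<Otimes>\<^sub>M borel)"
    using measurable_drift_kernel(1)[OF p_borel b_borel grad_p_exists]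
    by (simp add: P_def case_prod_beta)
  have K_measurable: "case_prod K \<in> borel_measurable (borel \<Otimes>\<^sub>M borel)"
    using measurable_drift_kernel(2)[OF p_borel b_borel grad_p_exists]
    by (simp add: K_def case_prod_beta)
  interpret perturbed_kernel Q P K \<eta>
  proof
    show "0 \<le> Q r v" for r v by (rule Q_nonneg)
    show "r < u \<Longrightarrow> u < v \<Longrightarrow> Q r u + Q u v \<le> Q r v" for r u v by (rule Q_superadditive)
    show "case_prod P \<in> borel_measurable (borel \<Otimes>\<^sub>M borel)" by (rule P_measurable)
    show "case_prod K \<in> borel_measurable (borel \<Otimes>\<^sub>M borel)" by (rule K_measurable)
    show "0 \<le> P a c" for a c by (auto simp: P_def p_nonneg split: prod.split)
    show "\<not> fst a < fst c \<Longrightarrow> P a c = 0" for a c by (cases a; cases c) (simp add: P_simp)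
    show "\<not> fst a < fst c \<Longrightarrow> K a c = 0" for a c by (cases a; cases c) (simp add: K_simp)
    show "0 \<le> \<eta>" by (rule eta)
    show "has_bochner_integral lborel (\<lambda>z. P a (u, z) * P (u, z) c) (P a c)"
      if "fst a < u" "u < fst c" for a u c
      using chapman_kolmogorov[OF that] that by (cases a; cases c) (auto simp: P_simp)
    show "has_bochner_integral lborel (\<lambda>z. K a (u, z) * P (u, z) c) (K a c)"
      if "fst a < u" "u < fst c" for a u c
      \<comment> \<open>The vector \<open>b (fst a) (snd a)\<close> does not depend on the
        integration variable, so its inner product passes under the gradient integral.\<close>
      using has_bochner_integral_inner_right[OF grad_p_integral[OF that], of "b (fst a) (snd a)" "snd c" "snd a"] that
      by (cases a; cases c) (auto simp: P_simp K_simp mult.commute)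
    show "(\<integral>\<^sup>+e. ennreal (P a e) * ennreal \<bar>K e c\<bar> \<partial>lborel) \<le> ennreal ((\<eta> + Q (fst a) (fst c)) * P a c)"
      if "fst a < fst c" for a c
    proof -
      obtain s x t y where ac: "a = (s, x)" "c = (t, y)" by (cases a; cases c) auto
      have [measurable]: "(\<lambda>e. P a e) \<in> borel_measurable borel" "(\<lambda>e. K e c) \<in> borel_measurable borel"
        using measurable_compose[OF measurable_Pair1' P_measurable, of a]
          measurable_compose[OF measurable_Pair2' K_measurable, of c] by auto
      \<comment> \<open>Tonelli separates time from space; the Cauchy-Schwarz inequality then
        compares with the integrand of \<open>class_N\<close>, and the supports restrict time to the
        open interval.\<close>
      have "(\<integral>\<^sup>+e. ennreal (P a e) * ennreal \<bar>K e c\<bar> \<partial>lborel)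
          = (\<integral>\<^sup>+u. (\<integral>\<^sup>+z. ennreal (P a (u, z)) * ennreal \<bar>K (u, z) c\<bar> \<partial>lborel) \<partial>lborel)"
        unfolding lborel_prod[symmetric]
        by (subst lborel.nn_integral_fst[symmetric]) (auto simp: lborel_prod)
      also have "\<dots> \<le> (\<integral>\<^sup>+u\<in>{s<..<t}. (\<integral>\<^sup>+z. ennreal (p s x u z * norm (b u z) * norm (grad (\<lambda>w. p u w t y) z)) \<partial>lborel) \<partial>lborel)"
      proof (intro nn_integral_mono)
        fix u
        have "ennreal (P a (u, z)) * ennreal \<bar>K (u, z) c\<bar>
            \<le> ennreal (p s x u z * norm (b u z) * norm (grad (\<lambda>w. p u w t y) z)) * indicator {s<..<t} u" for z
          using Cauchy_Schwarz_ineq2[of "b u z" "grad (\<lambda>w. p u w t y) z"]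
          by (auto simp: ac P_simp K_simp p_nonneg mult.assoc ennreal_mult[symmetric]
              intro!: ennreal_leI mult_left_mono split: split_indicator)
        then show "(\<integral>\<^sup>+z. ennreal (P a (u, z)) * ennreal \<bar>K (u, z) c\<bar> \<partial>lborel)
            \<le> (\<integral>\<^sup>+z. ennreal (p s x u z * norm (b u z) * norm (grad (\<lambda>w. p u w t y) z)) \<partial>lborel) * indicator {s<..<t} u"
        proof (cases "u \<in> {s<..<t}")
          case False
          then have "ennreal (P a (u, z)) * ennreal \<bar>K (u, z) c\<bar> = 0" for z
            by (auto simp: ac P_simp K_simp)
          then show ?thesis by (simp only: nn_integral_const mult_zero_left zero_le)
        qed (auto intro!: nn_integral_mono)
      qed
      also have "\<dots> \<le> ennreal ((\<eta> + Q s t) * p s x t y)"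
        using b_N that by (auto simp: class_N_def ac)
      finally show ?thesis using that by (simp add: ac P_simp)
    qed
  qed
  \<comment> \<open>Fubini, justified by \<open>integrable_kterm_K\<close>, identifies the
    space-time integral with the iterated one of the definition.\<close>
  have kterm: "pert_term p b n s x t y = kterm n (s, x) (t, y)" if "s < t" for n s x t y
    using that
  proof (induction n arbitrary: t y)
    case (Suc n)
    let ?f = "\<lambda>e. kterm n (s, x) e * K e (t, y)"
    have "integrable (lborel \<Otimes>\<^sub>M lborel) ?f"
      unfolding lborel_prod by (rule integrable_kterm_K)
    from lborel_pair.integral_fst'[OF this]
    have "kterm (Suc n) (s, x) (t, y) = (LINT u|lborel. LINT z|lborel. ?f (u, z))"
      by (simp add: lborel_prod)
    also have "\<dots> = pert_term p b (Suc n) s x t y"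
      unfolding pert_term.simps set_lebesgue_integral_def
    proof (intro Bochner_Integration.integral_cong refl)
      fix u
      show "(LINT z|lborel. ?f (u, z))
          = indicator {s<..<t} u *\<^sub>R (LINT z|lborel. pert_term p b n s x u z * (b u z \<bullet> grad (\<lambda>w. p u w t y) z))"
        \<comment> \<open>For \<open>u \<le> s\<close> the factor \<open>kterm n\<close> vanishes,
          for \<open>u \<ge> t\<close> the factor \<open>K\<close>; in between the induction
          hypothesis applies.\<close>
        using Suc.IH[of u] kterm_support[of "(s, x)" "(u, _)" n]
        by (cases "u \<in> {s<..<t}") (auto simp: K_simp)
    qed
    finally show ?case by simp
  qed (simp add: P_simp)
  then have kseries: "pert_series p b s x t y = kseries (s, x) (t, y)" if "s < t" for s x t y
    using that by (simp add: pert_series_def kseries_def)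
  define \<theta> where "\<theta> = (1 - \<eta>) / 2"
  have \<theta>: "0 < \<theta>" "\<eta> + \<theta> < 1" using eta by (auto simp: \<theta>_def field_simps)
  have "summable (\<lambda>n. \<bar>pert_term p b n s x t y\<bar>)" if "s < t" for s t x y
    using summable_kterm[OF kmaj_total_bound[OF _ \<theta>], of "(s, x)" "(t, y)"] that by (simp add: kterm)
  moreover obtain C where "C > 1"
    and C: "\<And>a c. fst a < fst c \<Longrightarrow> P a c / C powr (1 + Q (fst a) (fst c)) \<le> kseries a c"
    using kseries_lower_bound_uniform[OF eta(2)] by blast
  have "p s x t y / C powr (1 + Q s t) \<le> pert_series p b s x t y \<and>
       pert_series p b s x t y \<le> p s x t y *
         (if \<eta> = 0 then exp (Q s t) else (1 / (1 - 2 * \<eta>)) powr (1 + Q s t / \<eta>))"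
    if "s < t" for s t x y
    using C[of "(s, x)" "(t, y)"] kseries_upper_bound[of "(s, x)" "(t, y)"] that eta(2)
    by (auto simp: kseries P_simp split: if_splits)
  moreover have "has_bochner_integral lborel (\<lambda>z. pert_series p b s x u z * pert_series p b u z t y)
      (pert_series p b s x t y)" if "s < u" "u < t" for s u t x y
    using kseries_chapman_kolmogorov[of "(s, x)" u "(t, y)"] that eta by (simp add: kseries)
  ultimately show ?thesis using \<open>C > 1\<close> by blast
qed

end
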